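(* Let $V$ be a vector space and $f:V\to V$ a linear endomorphism. Let $k\ge 0$, $w_1,\ldots,w_k\in T(V,f)$, $x\in V$ and $w\in T(V,f)$. In $S(T(V,f))$: 1. If $k\ge 1$, $\emptyset\bullet(w_1\times\ldots\times w_k)=0$. 2. $\displaystyle xw\bullet(w_1\times\ldots\times w_k)=\sum_{I\subseteq\{1,\ldots,k\}}f^{k-|I|}(x)\big((w\bullet w_I)\sqcup\!\sqcup w_{\overline{I}}^{\sqcup\!\sqcup}\big)$, where $\overline I=\{1,\ldots,k\}\setminus I$. 3. $\emptyset\star(w_1\times\ldots\times w_k)=\emptyset\times w_1\times\ldots\times w_k$. 4. $\displaystyle xw\star(w_1\times\ldots\times w_k)=\sum_{(I,J,K)}\Big(f^{|J|}(x)\big((w\bullet w_I)\sqcup\!\sqcup w_J^{\sqcup\!\sqcup}\big)\Big)\times w_K$, where the sum is over all triples $(I,J,K)$ of pairwise disjoint (possibly empty) subsets of $\{1,\ldots,k\}$ with union $\{1,\ldots,k\}$.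
   Context: $\mathbb{K}$ is a field of characteristic zero. For a vector space $V$, $T(V)=\bigoplus_{n\ge 0}V^{\otimes n}$ is spanned by words with letters in $V$; $\emptyset$ is the empty word; juxtaposition denotes concatenation. The shuffle product $\sqcup\!\sqcup$ is the bilinear (commutative, associative) product with unit $\emptyset$ and $xu\sqcup\!\sqcup yv=x(u\sqcup\!\sqcup yv)+y(xu\sqcup\!\sqcup v)$ for $x,y\in V$, $u,v\in T(V)$. The bilinear product $\bullet$ on $T(V)$ is defined by $\emptyset\bullet w'=0$ and $(xw)\bullet w'=x(w\bullet w')+f(x)(w\sqcup\!\sqcup w')$ for $x\in V$, $w,w'\in T(V)$. It is a right pre-Lie product, and $T(V,f)$ denotes $T(V)$ with it. $S(T(V,f))$ is the symmetric algebra of the vector space $T(V,f)$, with product denoted $\times$ and unit $1$ (distinct from $\emptyset$), and with the usual coproduct $\Delta(z)=z^{(1)}\otimes z^{(2)}$, the algebra morphism for which elements of $T(V,f)$ are primitive. Following Oudom and Guin, $\bullet$ is extended to $S(T(V,f))\otimes S(T(V,f))\to S(T(V,f))$ by: $y\bullet 1=y$ for all $y\in S(T(V,f))$; $1\bullet z=\varepsilon(z)1$, where $\varepsilon$ is the counit; for $u,u_1,\ldots,u_k\in T(V,f)$, $u\bullet(u_1\times\ldots\times u_k)=(u\bullet(u_1\times\ldots\times u_{k-1}))\bullet u_k-u\bullet((u_1\times\ldots\times u_{k-1})\bullet u_k)$; and $(y\times y')\bullet z=(y\bullet z^{(1)})\times(y'\bullet z^{(2)})$. The associative product $\star$ is $y\star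 z=(y\bullet z^{(1)})\times z^{(2)}$; it makes $S(T(V,f))$ the enveloping algebra of the Lie algebra of $T(V,f)$. For $I=\{i_1,\ldots,i_p\}\subseteq\{1,\ldots,k\}$: $w_I=w_{i_1}\times\ldots\times w_{i_p}\in S(T(V,f))$ and $w_I^{\sqcup\!\sqcup}=w_{i_1}\sqcup\!\sqcup\ldots\sqcup\!\sqcup w_{i_p}\in T(V,f)$, with $w_I=1$ and $w_I^{\sqcup\!\sqcup}=\emptyset$ (the empty word) if $I$ is empty. *)

theory Defs
  imports Complex_Main "HOL-Library.Multiset" "HOL-Library.Poly_Mapping"
begin

text \<open>
  The scalar multiplication of a vector space over an arbitrary field is an explicit parameter, as in
  the locale \<^locale>\<open>vector_space\<close>, so no type can depend on it.  Tensor and symmetric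
  algebras are therefore specified as types equipped with an isomorphism to the usual quotient of a
  free vector space: \<open>presented s g R\<close> says that the linear map sending the basis element
  \<open>a\<close> of the free vector space on \<^typ>\<open>'a\<close> to \<open>g a\<close> is onto, with kernel
  spanned by \<open>R\<close>.
\<close>

definition free_scale :: "'k::field \<Rightarrow> ('a \<Rightarrow>\<^sub>0 'k) \<Rightarrow> ('a \<Rightarrow>\<^sub>0 'k)" where
  "free_scale c p = Poly_Mapping.map ((*) c) p"

lemma lookup_free_scale: "Poly_Mapping.lookup (free_scale c p) a = c * Poly_Mapping.lookup p a"
  unfolding free_scale_def by (simp add: Poly_Mapping.map.rep_eq when_def)

lemma vector_space_free_scale: "vector_space free_scale"
  by unfold_locales
    (auto intro!: poly_mapping_eqI simp: lookup_free_scale lookup_add algebra_simps)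

definition lin_ext ::
  "('k::field \<Rightarrow> 'w::ab_group_add \<Rightarrow> 'w) \<Rightarrow> ('a \<Rightarrow> 'w) \<Rightarrow> ('a \<Rightarrow>\<^sub>0 'k) \<Rightarrow> 'w" where
  "lin_ext s g p = (\<Sum>a\<in>Poly_Mapping.keys p. s (Poly_Mapping.lookup p a) (g a))"

definition presented ::
  "('k::field \<Rightarrow> 'w::ab_group_add \<Rightarrow> 'w) \<Rightarrow> ('a \<Rightarrow> 'w) \<Rightarrow> ('a \<Rightarrow>\<^sub>0 'k) set \<Rightarrow> bool" where
  "presented s g R \<longleftrightarrow>
     surj (lin_ext s g) \<and> {p. lin_ext s g p = 0} = module.span free_scale R"

definition bilinear_map ::
  "('k::field \<Rightarrow> 'a::ab_group_add \<Rightarrow> 'a) \<Rightarrow> ('k \<Rightarrow> 'b::ab_group_add \<Rightarrow> 'b) \<Rightarrow>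
   ('k \<Rightarrow> 'c::ab_group_add \<Rightarrow> 'c) \<Rightarrow> ('a \<Rightarrow> 'b \<Rightarrow> 'c) \<Rightarrow> bool" where
  "bilinear_map s1 s2 s3 h \<longleftrightarrow>
     (\<forall>x. Vector_Spaces.linear s2 s3 (h x)) \<and> (\<forall>y. Vector_Spaces.linear s1 s3 (\<lambda>x. h x y))"

definition algebra_over :: "('k::field \<Rightarrow> 'a::ring_1 \<Rightarrow> 'a) \<Rightarrow> bool" where
  "algebra_over s \<longleftrightarrow> vector_space s \<and> bilinear_map s s s (*)"

definition algebra_hom ::
  "('k::field \<Rightarrow> 'a::ring_1 \<Rightarrow> 'a) \<Rightarrow> ('k \<Rightarrow> 'b::ring_1 \<Rightarrow> 'b) \<Rightarrow> ('a \<Rightarrow> 'b) \<Rightarrow> bool" where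
  "algebra_hom s1 s2 h \<longleftrightarrow>
     Vector_Spaces.linear s1 s2 h \<and> h 1 = 1 \<and> (\<forall>x y. h (x * y) = h x * h y)"


text \<open>
  \<open>T(V)\<close> is the free vector space on lists over \<open>V\<close> modulo multilinearity.  The ring
  multiplication of \<^typ>\<open>'t\<close> is concatenation, \<open>1\<close> is the empty word, and
  \<open>\<iota> : V \<rightarrow> T(V)\<close> embeds the letters, so that \<open>\<iota> x * w\<close> is the word
  \<open>xw\<close>.
\<close>

definition tensor_relations ::
  "('k::field \<Rightarrow> 'v::ab_group_add \<Rightarrow> 'v) \<Rightarrow> ('v list \<Rightarrow>\<^sub>0 'k) set" where
  "tensor_relations sV =
     {Poly_Mapping.single (u @ (x + y) # v) 1 - Poly_Mapping.single (u @ x # v) 1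
        - Poly_Mapping.single (u @ y # v) 1 | u x y v. True}
     \<union> {Poly_Mapping.single (u @ sV c x # v) 1 - Poly_Mapping.single (u @ x # v) c | u c x v. True}"

definition tensor_algebra ::
  "('k::field \<Rightarrow> 'v::ab_group_add \<Rightarrow> 'v) \<Rightarrow> ('k \<Rightarrow> 't::ring_1 \<Rightarrow> 't) \<Rightarrow> ('v \<Rightarrow> 't) \<Rightarrow> bool" where
  "tensor_algebra sV sT \<iota> \<longleftrightarrow>
     vector_space sV \<and> algebra_over sT \<and>
     presented sT (\<lambda>xs. prod_list (map \<iota> xs)) (tensor_relations sV)"

text \<open>
  \<open>S(W)\<close> is the free vector space on finite multisets over \<open>W\<close> modulo multilinearity,
  with canonical embedding \<open>j : W \<rightarrow> S(W)\<close>; its product is the ring multiplication of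
  \<^typ>\<open>'s\<close>.
\<close>

definition symmetric_relations ::
  "('k::field \<Rightarrow> 'w::ab_group_add \<Rightarrow> 'w) \<Rightarrow> ('w multiset \<Rightarrow>\<^sub>0 'k) set" where
  "symmetric_relations sW =
     {Poly_Mapping.single (add_mset (a + b) M) 1 - Poly_Mapping.single (add_mset a M) 1
        - Poly_Mapping.single (add_mset b M) 1 | a b M. True}
     \<union> {Poly_Mapping.single (add_mset (sW c a) M) 1 - Poly_Mapping.single (add_mset a M) c
          | c a M. True}"

definition symmetric_algebra ::
  "('k::field \<Rightarrow> 'w::ab_group_add \<Rightarrow> 'w) \<Rightarrow> ('k \<Rightarrow> 's::comm_ring_1 \<Rightarrow> 's) \<Rightarrow> ('w \<Rightarrow> 's) \<Rightarrow> bool" where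
  "symmetric_algebra sW sS j \<longleftrightarrow>
     vector_space sW \<and> algebra_over sS \<and>
     presented sS (\<lambda>M. \<Prod>a\<in>#M. j a) (symmetric_relations sW)"

definition tensor_square_relations ::
  "('k::field \<Rightarrow> 's::ab_group_add \<Rightarrow> 's) \<Rightarrow> ('s \<times> 's \<Rightarrow>\<^sub>0 'k) set" where
  "tensor_square_relations s =
     {Poly_Mapping.single (a + b, c) 1 - Poly_Mapping.single (a, c) 1
        - Poly_Mapping.single (b, c) 1 | a b c. True}
     \<union> {Poly_Mapping.single (a, b + c) 1 - Poly_Mapping.single (a, b) 1
        - Poly_Mapping.single (a, c) 1 | a b c. True}
     \<union> {Poly_Mapping.single (s r a, b) 1 - Poly_Mapping.single (a, b) r | r a b. True}
     \<union> {Poly_Mapping.single (a, s r b) 1 - Poly_Mapping.single (a, b) r | r a b. True}"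

definition tensor_square ::
  "('k::field \<Rightarrow> 's::ring_1 \<Rightarrow> 's) \<Rightarrow> ('k \<Rightarrow> 'ss::ring_1 \<Rightarrow> 'ss) \<Rightarrow> ('s \<Rightarrow> 's \<Rightarrow> 'ss) \<Rightarrow> bool" where
  "tensor_square sS sSS tns \<longleftrightarrow>
     algebra_over sS \<and> algebra_over sSS \<and>
     presented sSS (\<lambda>(a, b). tns a b) (tensor_square_relations sS) \<and>
     tns 1 1 = 1 \<and> (\<forall>a b c d. tns a b * tns c d = tns (a * c) (b * d))"


definition shuffle ::
  "('k::field \<Rightarrow> 't::ring_1 \<Rightarrow> 't) \<Rightarrow> ('v \<Rightarrow> 't) \<Rightarrow> 't \<Rightarrow> 't \<Rightarrow> 't" where
  "shuffle sT \<iota> = (THE sh. bilinear_map sT sT sT sh \<and>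
     (\<forall>w. sh 1 w = w) \<and> (\<forall>w. sh w 1 = w) \<and>
     (\<forall>x y u v. sh (\<iota> x * u) (\<iota> y * v)
        = \<iota> x * sh u (\<iota> y * v) + \<iota> y * sh (\<iota> x * u) v))"

definition prelie ::
  "('k::field \<Rightarrow> 't::ring_1 \<Rightarrow> 't) \<Rightarrow> ('v \<Rightarrow> 't) \<Rightarrow> ('v \<Rightarrow> 'v) \<Rightarrow> 't \<Rightarrow> 't \<Rightarrow> 't" where
  "prelie sT \<iota> f = (THE b. bilinear_map sT sT sT b \<and>
     (\<forall>w'. b 1 w' = 0) \<and>
     (\<forall>x w w'. b (\<iota> x * w) w' = \<iota> x * b w w' + \<iota> (f x) * shuffle sT \<iota> w w'))"

definition shuffle_set ::
  "('k::field \<Rightarrow> 't::ring_1 \<Rightarrow> 't) \<Rightarrow> ('v \<Rightarrow> 't) \<Rightarrow> (nat \<Rightarrow> 't) \<Rightarrow> nat set \<Rightarrow> 't" where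
  "shuffle_set sT \<iota> ws I = foldr (shuffle sT \<iota>) (map ws (sorted_list_of_set I)) 1"


definition counit ::
  "('k::field \<Rightarrow> 's::comm_ring_1 \<Rightarrow> 's) \<Rightarrow> ('t \<Rightarrow> 's) \<Rightarrow> 's \<Rightarrow> 'k" where
  "counit sS j = (THE e. algebra_hom sS (*) e \<and> (\<forall>a. e (j a) = 0))"

definition coproduct ::
  "('k::field \<Rightarrow> 's::comm_ring_1 \<Rightarrow> 's) \<Rightarrow> ('t \<Rightarrow> 's) \<Rightarrow>
   ('k \<Rightarrow> 'ss::ring_1 \<Rightarrow> 'ss) \<Rightarrow> ('s \<Rightarrow> 's \<Rightarrow> 'ss) \<Rightarrow> 's \<Rightarrow> 'ss" where
  "coproduct sS j sSS tns = (THE D. algebra_hom sS sSS D \<and>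
     (\<forall>a. D (j a) = tns (j a) 1 + tns 1 (j a)))"

text \<open>\<open>sweedler \<dots> h z\<close> is \<open>h (z\<^sup>(\<^sup>1\<^sup>)) (z\<^sup>(\<^sup>2\<^sup>))\<close> for bilinear \<open>h\<close>.\<close>

definition sweedler ::
  "('k::field \<Rightarrow> 's::comm_ring_1 \<Rightarrow> 's) \<Rightarrow> ('t \<Rightarrow> 's) \<Rightarrow>
   ('k \<Rightarrow> 'ss::ring_1 \<Rightarrow> 'ss) \<Rightarrow> ('s \<Rightarrow> 's \<Rightarrow> 'ss) \<Rightarrow> ('s \<Rightarrow> 's \<Rightarrow> 's) \<Rightarrow> 's \<Rightarrow> 's" where
  "sweedler sS j sSS tns h z =
     (THE L. Vector_Spaces.linear sSS sS L \<and> (\<forall>a b. L (tns a b) = h a b))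
       (coproduct sS j sSS tns z)"

text \<open>The Oudom--Guin extension of a right pre-Lie product \<open>b\<close> on \<open>W\<close> to
  \<open>S(W)\<close>.\<close>

definition oudom_guin ::
  "('k::field \<Rightarrow> 's::comm_ring_1 \<Rightarrow> 's) \<Rightarrow> ('t \<Rightarrow> 's) \<Rightarrow>
   ('k \<Rightarrow> 'ss::ring_1 \<Rightarrow> 'ss) \<Rightarrow> ('s \<Rightarrow> 's \<Rightarrow> 'ss) \<Rightarrow> ('t \<Rightarrow> 't \<Rightarrow> 't) \<Rightarrow> 's \<Rightarrow> 's \<Rightarrow> 's" where
  "oudom_guin sS j sSS tns b = (THE B. bilinear_map sS sS sS B \<and>
     (\<forall>u v. B (j u) (j v) = j (b u v)) \<and>
     (\<forall>y. B y 1 = y) \<and>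
     (\<forall>z. B 1 z = sS (counit sS j z) 1) \<and>
     (\<forall>u us v. B (j u) (prod_list (map j us) * j v)
        = B (B (j u) (prod_list (map j us))) (j v) - B (j u) (B (prod_list (map j us)) (j v))) \<and>
     (\<forall>y y' z. B (y * y') z = sweedler sS j sSS tns (\<lambda>z1 z2. B y z1 * B y' z2) z))"

text \<open>For \<open>w\<close> in \<open>W\<close> the element \<open>w \<bullet> z\<close> of \<open>S(W)\<close> lies in
  the copy \<open>j ` W\<close> of \<open>W\<close>; this is that element, read in \<open>W\<close>.\<close>

definition oudom_guin_elem ::
  "('k::field \<Rightarrow> 's::comm_ring_1 \<Rightarrow> 's) \<Rightarrow> ('t \<Rightarrow> 's) \<Rightarrow>
   ('k \<Rightarrow> 'ss::ring_1 \<Rightarrow> 'ss) \<Rightarrow> ('s \<Rightarrow> 's \<Rightarrow> 'ss) \<Rightarrow> ('t \<Rightarrow> 't \<Rightarrow> 't) \<Rightarrow> 't \<Rightarrow> 's \<Rightarrow> 't" where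
  "oudom_guin_elem sS j sSS tns b w z = (THE t. j t = oudom_guin sS j sSS tns b (j w) z)"

definition star ::
  "('k::field \<Rightarrow> 's::comm_ring_1 \<Rightarrow> 's) \<Rightarrow> ('t \<Rightarrow> 's) \<Rightarrow>
   ('k \<Rightarrow> 'ss::ring_1 \<Rightarrow> 'ss) \<Rightarrow> ('s \<Rightarrow> 's \<Rightarrow> 'ss) \<Rightarrow> ('t \<Rightarrow> 't \<Rightarrow> 't) \<Rightarrow> 's \<Rightarrow> 's \<Rightarrow> 's" where
  "star sS j sSS tns b y z =
     sweedler sS j sSS tns (\<lambda>z1 z2. oudom_guin sS j sSS tns b y z1 * z2) z"

end

theory Submission
  imports Defs
begin

text \<open>
  Every operation is given as the only solution of its defining equations, so a solution has to be
  constructed and its uniqueness shown.  A tensor or symmetric algebra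
  is presented by multilinearity relations; hence multilinear functions on lists or multisets lift to
  linear maps, and this yields the shuffle product, the pre-Lie product, the counit, the coproduct
  and Sweedler sums.

  The Oudom--Guin extension is the essential point.  Instead of extending a general pre-Lie product
  and deriving the formula for \<open>xw \<bullet> (w\<^sub>1 \<times> \<dots> \<times> w\<^sub>k)\<close> afterwards, the formula is used as a definition.
  In terms of the coproduct it reads
  \<open>xw \<bullet> z = f\<^sup>d(x) ((w \<bullet> z\<^sup>(\<^sup>1\<^sup>)) \<squnion> z\<^sup>(\<^sup>2\<^sup>))\<close>, where \<open>d\<close> is the degree of \<open>z\<^sup>(\<^sup>2\<^sup>)\<close> and \<open>\<squnion>\<close> shuffles
  with all factors of \<open>z\<^sup>(\<^sup>2\<^sup>)\<close>; together with \<open>\<emptyset> \<bullet> z = \<epsilon>(z) \<emptyset>\<close> it defines an action of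
  \<open>S(T(V))\<close> on \<open>T(V)\<close> by recursion on words.  Linear endomorphisms of \<open>S(T(V))\<close> form a commutative
  algebra under convolution, because the coproduct is coassociative and cocommutative
  (\<open>sw_left_commute\<close>); so the action on generators extends to an algebra morphism
  \<open>y \<mapsto> (y \<bullet> _)\<close>, which is the multiplicativity required of the extension (\<open>conv_ext_mult\<close>).

  It remains to verify the recursion \<open>w \<bullet> (z \<times> v) = (w \<bullet> z) \<bullet> v - w \<bullet> (z \<bullet> v)\<close>
  (\<open>act_mult_j\<close>).  It follows by induction on \<open>w\<close> from two facts: \<open>_ \<bullet> v\<close> is a derivation of the
  shuffle algebra (\<open>pl_sh\<close>), and on \<open>S(T(V))\<close> it is both a derivation and a coderivation
  (\<open>og_leibniz\<close>, \<open>sw_og_j\<close>).  Conversely, the recursion determines the extension by induction on the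
  degree of the right argument (\<open>oudom_guin_eq\<close>).

  The formulas for \<open>\<bullet>\<close> and \<open>\<star>\<close> then result from writing the coproduct of a product of
  generators as a sum over subsets (\<open>sw_prod\<close>).
\<close>

section \<open>Linear maps out of presented vector spaces\<close>

lemma bilinear_mapI:
  assumes "vector_space s1" "vector_space s2" "vector_space s3"
    and "\<And>x x' y. h (x + x') y = h x y + h x' y" "\<And>c x y. h (s1 c x) y = s3 c (h x y)"
    and "\<And>x y y'. h x (y + y') = h x y + h x y'" "\<And>c x y. h x (s2 c y) = s3 c (h x y)"
  shows "bilinear_map s1 s2 s3 h"
  using assms unfolding bilinear_map_def Vector_Spaces.linear_iff by auto

lemma bilinear_mapD:
  assumes "bilinear_map s1 s2 s3 h"
  shows "h (x + x') y = h x y + h x' y" "h (s1 c x) y = s3 c (h x y)"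
    and "h x (y + y') = h x y + h x y'" "h x (s2 c y) = s3 c (h x y)"
  using assms unfolding bilinear_map_def Vector_Spaces.linear_iff by auto

lemma bilinear_map_zero:
  assumes "bilinear_map s1 s2 s3 h"
  shows "h 0 y = 0" "h x 0 = 0"
  using bilinear_mapD(1)[OF assms, of 0 0 y] bilinear_mapD(3)[OF assms, of x 0 0] by simp_all

lemma linearD:
  assumes "Vector_Spaces.linear s1 s2 F"
  shows "F (a + b) = F a + F b" "F (s1 c a) = s2 c (F a)"
  using assms by (auto simp: Vector_Spaces.linear_iff)

lemma linear_0: "Vector_Spaces.linear s1 s2 F \<Longrightarrow> F 0 = 0"
  by (metis add_cancel_right_right linearD(1))

lemma lin_ext_superset:
  assumes "vector_space s" "finite K" "Poly_Mapping.keys p \<subseteq> K"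
  shows "lin_ext s g p = (\<Sum>a\<in>K. s (Poly_Mapping.lookup p a) (g a))"
proof -
  interpret vector_space s by fact
  show ?thesis
    unfolding lin_ext_def using assms(2,3)
    by (intro sum.mono_neutral_left) (auto simp: in_keys_iff)
qed

lemma linear_lin_ext:
  assumes "vector_space s"
  shows "Vector_Spaces.linear free_scale s (lin_ext s g)"
proof -
  interpret vector_space s by fact
  have "lin_ext s g (p + q) = lin_ext s g p + lin_ext s g q" for p q
  proof -
    let ?K = "Poly_Mapping.keys p \<union> Poly_Mapping.keys q"
    have "Poly_Mapping.keys (p + q) \<subseteq> ?K"
      by (rule Poly_Mapping.keys_add)
    then show ?thesis
      by (simp add: lin_ext_superset[OF assms, where K = ?K] lookup_add scale_left_distrib sum.distrib)
  qed
  moreover have "lin_ext s g (free_scale c p) = s c (lin_ext s g p)" for c p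
  proof -
    have "Poly_Mapping.keys (free_scale c p) \<subseteq> Poly_Mapping.keys p"
      by (auto simp: in_keys_iff lookup_free_scale)
    then show ?thesis
      by (simp add: lin_ext_superset[OF assms, where K = "Poly_Mapping.keys p"] lookup_free_scale
          scale_sum_right)
  qed
  ultimately show ?thesis
    using assms vector_space_free_scale by (simp add: Vector_Spaces.linear_iff)
qed

lemma lin_ext_diff:
  assumes "vector_space s"
  shows "lin_ext s g (p - q) = lin_ext s g p - lin_ext s g q"
  by (metis linear_lin_ext[OF assms] linearD(1) add_diff_cancel diff_add_cancel)

lemma lin_ext_single:
  assumes "vector_space s"
  shows "lin_ext s g (Poly_Mapping.single a c) = s c (g a)"
proof -
  interpret vector_space s by fact
  show ?thesis
    by (simp add: lin_ext_superset[OF assms, where K = "{a}"] del: lookup_single)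
qed

text \<open>The relations are the only constraint: a function on the generators that respects them is
  the restriction of a linear map.  Evaluating at an arbitrary preimage gives this map.\<close>

definition lift_presented ::
  "('k::field \<Rightarrow> 'w::ab_group_add \<Rightarrow> 'w) \<Rightarrow> ('a \<Rightarrow> 'w) \<Rightarrow>
   ('k \<Rightarrow> 'x::ab_group_add \<Rightarrow> 'x) \<Rightarrow> ('a \<Rightarrow> 'x) \<Rightarrow> 'w \<Rightarrow> 'x" where
  "lift_presented s g sX G y = lin_ext sX G (SOME p. lin_ext s g p = y)"

lemma lift_presented:
  assumes P: "presented s g R" and s: "vector_space s" and X: "vector_space sX"
    and R: "\<And>r. r \<in> R \<Longrightarrow> lin_ext sX G r = 0"
  shows "Vector_Spaces.linear s sX (lift_presented s g sX G)"
    and "lift_presented s g sX G (g a) = G a"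
proof -
  interpret F: vector_space free_scale by (rule vector_space_free_scale)
  interpret X: vector_space sX by fact
  interpret S: vector_space s by fact
  let ?E = "lin_ext s g" and ?L = "lift_presented s g sX G"
  have ker: "lin_ext sX G p = 0" if "?E p = 0" for p
  proof -
    have "p \<in> F.span R" using P that by (auto simp: presented_def)
    then show ?thesis
      by (induct rule: F.span_induct_alt)
        (simp_all add: linearD[OF linear_lin_ext[OF X]] linear_0[OF linear_lin_ext[OF X]] R)
  qed
  have L: "?L (?E p) = lin_ext sX G p" for p
  proof -
    have "?E (SOME q. ?E q = ?E p) = ?E p" by (rule someI) simp
    then have "?E ((SOME q. ?E q = ?E p) - p) = 0" by (simp add: lin_ext_diff[OF s])
    then show ?thesis unfolding lift_presented_def
      using ker by (force simp: lin_ext_diff[OF X])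
  qed
  have ex: "\<exists>p. y = ?E p" for y using P by (auto simp: presented_def surj_def)
  have "?L (y + z) = ?L y + ?L z" for y z
    by (metis L ex linearD(1)[OF linear_lin_ext[OF s]] linearD(1)[OF linear_lin_ext[OF X]])
  moreover have "?L (s c y) = sX c (?L y)" for c y
    by (metis L ex linearD(2)[OF linear_lin_ext[OF s]] linearD(2)[OF linear_lin_ext[OF X]])
  ultimately show "Vector_Spaces.linear s sX ?L"
    using s X by (simp add: Vector_Spaces.linear_iff)
  show "?L (g a) = G a"
    using L[of "Poly_Mapping.single a 1"] by (simp add: lin_ext_single[OF s] lin_ext_single[OF X])
qed

lemma presented_relation:
  assumes "presented s g R" "r \<in> R"
  shows "lin_ext s g r = 0"
proof -
  interpret F: vector_space free_scale by (rule vector_space_free_scale)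
  show ?thesis using F.span_base[OF assms(2)] assms(1) by (auto simp: presented_def)
qed

lemma presented_induct:
  assumes "presented s g R" and s: "vector_space s"
    and "\<And>a. P (g a)" "\<And>y z. P y \<Longrightarrow> P z \<Longrightarrow> P (y + z)" "\<And>c y. P y \<Longrightarrow> P (s c y)"
  shows "P y"
proof -
  interpret vector_space s by fact
  obtain p where p: "y = lin_ext s g p" using assms(1) by (auto simp: presented_def surj_def)
  have "P 0" by (metis assms(3,5) scale_zero_left)
  have "P (\<Sum>a\<in>K. s (Poly_Mapping.lookup p a) (g a))" if "finite K" for K
    using that by induct (auto intro: assms \<open>P 0\<close>)
  then show ?thesis by (simp add: p lin_ext_def)
qed

lemma ball_Collect_ex:
  "(\<forall>r\<in>{g a b c d | a b c d. True}. P r) \<longleftrightarrow> (\<forall>a b c d. P (g a b c d))"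
  "(\<forall>r\<in>{h a b c | a b c. True}. P r) \<longleftrightarrow> (\<forall>a b c. P (h a b c))"
  by blast+

section \<open>The tensor algebra\<close>

locale tensor_alg =
  fixes sV :: "'k::field \<Rightarrow> 'v::ab_group_add \<Rightarrow> 'v"
    and sT :: "'k \<Rightarrow> 't::ring_1 \<Rightarrow> 't" and \<iota> :: "'v \<Rightarrow> 't"
  assumes tensor_algebra: "tensor_algebra sV sT \<iota>"
begin

lemma vs_T: "vector_space sT"
  and bilinear_mult: "bilinear_map sT sT sT (*)"
  and presented_T: "presented sT (\<lambda>xs. prod_list (map \<iota> xs)) (tensor_relations sV)"
  using tensor_algebra by (auto simp: tensor_algebra_def algebra_over_def)

sublocale T: vector_space sT by (rule vs_T)

abbreviation word :: "'v list \<Rightarrow> 't" where "word xs \<equiv> prod_list (map \<iota> xs)"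

lemma scale_mult: "sT c a * b = sT c (a * b)" "a * sT c b = sT c (a * b)"
  using bilinear_mapD[OF bilinear_mult] by auto

definition multilinear :: "('k \<Rightarrow> 'x::ab_group_add \<Rightarrow> 'x) \<Rightarrow> ('v list \<Rightarrow> 'x) \<Rightarrow> bool" where
  "multilinear sX G \<longleftrightarrow>
     (\<forall>u x y v. G (u @ (x + y) # v) = G (u @ x # v) + G (u @ y # v)) \<and>
     (\<forall>u c x v. G (u @ sV c x # v) = sX c (G (u @ x # v)))"

lemma multilinearI:
  assumes "\<And>u x y v. G (u @ (x + y) # v) = G (u @ x # v) + G (u @ y # v)"
    and "\<And>u c x v. G (u @ sV c x # v) = sX c (G (u @ x # v))"
  shows "multilinear sX G"
  using assms by (auto simp: multilinear_def)

text \<open>Respecting the tensor relations is multilinearity in the letters, so multilinear functions on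
  lists are what can be lifted to \<open>T(V)\<close>.\<close>

lemma tensor_relations_vanish_iff:
  fixes sX :: "'k \<Rightarrow> 'x::ab_group_add \<Rightarrow> 'x"
  assumes "vector_space sX"
  shows "(\<forall>r\<in>tensor_relations sV. lin_ext sX G r = 0) \<longleftrightarrow> multilinear sX G"
proof -
  interpret X: vector_space sX by fact
  have d: "a - b = c \<longleftrightarrow> a = b + c" for a b c :: 'x
    by (auto simp: algebra_simps)
  show ?thesis
    unfolding tensor_relations_def ball_Un multilinear_def ball_Collect_ex
    by (simp add: lin_ext_diff[OF assms] lin_ext_single[OF assms] d)
qed

lemma multilinear_word: "multilinear sT (\<lambda>xs. word xs)"
  using tensor_relations_vanish_iff[OF vs_T] presented_relation[OF presented_T] by blast

lemma word_multilinear: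
  "word (u @ (x + y) # v) = word (u @ x # v) + word (u @ y # v)"
  "word (u @ sV c x # v) = sT c (word (u @ x # v))"
  using multilinear_word unfolding multilinear_def by blast+

lemma iota_add: "\<iota> (x + y) = \<iota> x + \<iota> y" and iota_scale: "\<iota> (sV c x) = sT c (\<iota> x)"
  using word_multilinear[of "[]" _ _ "[]"] word_multilinear(2)[of "[]" _ _ "[]"] by simp_all

lemma T_induct [case_names one letter add scale]:
  assumes "P 1" "\<And>x w. P w \<Longrightarrow> P (\<iota> x * w)"
    and "\<And>a b. P a \<Longrightarrow> P b \<Longrightarrow> P (a + b)" "\<And>c a. P a \<Longrightarrow> P (sT c a)"
  shows "P t"
proof (rule presented_induct[OF presented_T vs_T])
  show "P (word xs)" for xs by (induct xs) (auto intro: assms)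
qed (use assms in auto)

abbreviation lift_T where "lift_T \<equiv> lift_presented sT word"

lemma
  assumes "vector_space sX" "multilinear sX G"
  shows linear_lift_T: "Vector_Spaces.linear sT sX (lift_T sX G)"
    and lift_T_word: "lift_T sX G (word xs) = G xs"
proof -
  have R: "lin_ext sX G r = 0" if "r \<in> tensor_relations sV" for r
    using that tensor_relations_vanish_iff assms by blast
  show "Vector_Spaces.linear sT sX (lift_T sX G)" "lift_T sX G (word xs) = G xs"
    using lift_presented[OF presented_T vs_T assms(1) R] by auto
qed

lemma lift_T_simps:
  assumes "vector_space sX" "multilinear sX G"
  shows "lift_T sX G (a + b) = lift_T sX G a + lift_T sX G b"
    and "lift_T sX G (sT c a) = sX c (lift_T sX G a)"
    and "lift_T sX G (word xs) = G xs"
  using linearD[OF linear_lift_T[OF assms]] lift_T_word[OF assms] by auto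

lemma word_induct [case_names word add scale]:
  assumes "\<And>xs. P (word xs)"
    and "\<And>a b. P a \<Longrightarrow> P b \<Longrightarrow> P (a + b)" "\<And>c a. P a \<Longrightarrow> P (sT c a)"
  shows "P t"
  by (rule presented_induct[OF presented_T vs_T]) (use assms in auto)

section \<open>The shuffle product\<close>

fun word_shuffle :: "'v list \<Rightarrow> 'v list \<Rightarrow> 't" where
  "word_shuffle [] ys = word ys"
| "word_shuffle xs [] = word xs"
| "word_shuffle (x # xs) (y # ys) = \<iota> x * word_shuffle xs (y # ys) + \<iota> y * word_shuffle (x # xs) ys"

lemma word_shuffle_Nil [simp]: "word_shuffle xs [] = word xs"
  by (cases xs) auto

lemma word_shuffle_commute: "word_shuffle xs ys = word_shuffle ys xs"
  by (induct xs ys rule: word_shuffle.induct) (auto simp: add.commute)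

text \<open>Multilinearity in one argument suffices: commutativity transports it to the other.\<close>

lemma word_shuffle_multilinear:
  "word_shuffle (u @ (x + y) # v) ys = word_shuffle (u @ x # v) ys + word_shuffle (u @ y # v) ys"
  "word_shuffle (u @ sV c x # v) ys = sT c (word_shuffle (u @ x # v) ys)"
proof -
  show "word_shuffle (u @ (x + y) # v) ys = word_shuffle (u @ x # v) ys + word_shuffle (u @ y # v) ys"
  proof (induct u arbitrary: ys)
    case Nil
    show ?case by (induct ys) (simp_all add: iota_add algebra_simps)
  next
    case (Cons a u)
    note IH = Cons
    show ?case
    proof (induct ys)
      case Nil
      then show ?case using word_multilinear(1)[of "a # u"] by simp
    qed (simp add: IH algebra_simps)
  qed
  show "word_shuffle (u @ sV c x # v) ys = sT c (word_shuffle (u @ x # v) ys)"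
  proof (induct u arbitrary: ys)
    case Nil
    show ?case by (induct ys) (simp_all add: iota_scale scale_mult T.scale_right_distrib)
  next
    case (Cons a u)
    note IH = Cons
    show ?case
    proof (induct ys)
      case Nil
      then show ?case using word_multilinear(2)[of "a # u"] by simp
    qed (simp add: IH scale_mult T.scale_right_distrib)
  qed
qed

text \<open>The shuffle of words is lifted to \<open>T(V)\<close> in two steps, one argument at a time.\<close>

definition sh_word :: "'t \<Rightarrow> 'v list \<Rightarrow> 't" where
  "sh_word t ys = lift_T sT (\<lambda>xs. word_shuffle xs ys) t"

lemma multilinear_word_shuffle: "multilinear sT (\<lambda>xs. word_shuffle xs ys)"
  by (rule multilinearI) (rule word_shuffle_multilinear)+

lemma sh_word_simps:
  "sh_word (a + b) ys = sh_word a ys + sh_word b ys"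
  "sh_word (sT c a) ys = sT c (sh_word a ys)"
  "sh_word (word xs) ys = word_shuffle xs ys"
  by (simp_all add: sh_word_def lift_T_simps[OF vs_T multilinear_word_shuffle])

lemma multilinear_sh_word: "multilinear sT (sh_word t)"
proof (rule multilinearI)
  show "sh_word t (u @ (x + y) # v) = sh_word t (u @ x # v) + sh_word t (u @ y # v)" for u x y v
    by (induct t rule: word_induct)
      (simp_all add: sh_word_simps word_shuffle_commute[of _ "_ @ _"] word_shuffle_multilinear
        algebra_simps T.scale_right_distrib)
  show "sh_word t (u @ sV c x # v) = sT c (sh_word t (u @ x # v))" for u c x v
    by (induct t rule: word_induct)
      (simp_all add: sh_word_simps word_shuffle_commute[of _ "_ @ _"] word_shuffle_multilinear
        T.scale_right_distrib mult.commute)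
qed

definition sh :: "'t \<Rightarrow> 't \<Rightarrow> 't" where
  "sh a b = lift_T sT (sh_word a) b"

lemma sh_word_word: "sh (word xs) (word ys) = word_shuffle xs ys"
  by (simp add: sh_def lift_T_word[OF vs_T multilinear_sh_word] sh_word_simps)

lemma sh_linear_right: "sh a (b + b') = sh a b + sh a b'" "sh a (sT c b) = sT c (sh a b)"
  by (simp_all add: sh_def lift_T_simps[OF vs_T multilinear_sh_word])

lemma sh_linear_left: "sh (a + a') b = sh a b + sh a' b" "sh (sT c a) b = sT c (sh a b)"
  and sh_commute: "sh a b = sh b a"
proof -
  have w: "sh a (word ys) = sh_word a ys" for a ys
    by (simp add: sh_def lift_T_word[OF vs_T multilinear_sh_word])
  show 1: "sh (a + a') b = sh a b + sh a' b" for a a' b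
    by (induct b rule: word_induct)
      (simp_all add: sh_linear_right w sh_word_simps algebra_simps T.scale_right_distrib)
  show 2: "sh (sT c a) b = sT c (sh a b)" for c a b
    by (induct b rule: word_induct)
      (simp_all add: sh_linear_right w sh_word_simps T.scale_right_distrib mult.commute)
  have "sh (word xs) b = sh b (word xs)" for xs
    by (induct b rule: word_induct)
      (simp_all add: sh_linear_right 1 2 sh_word_word word_shuffle_commute)
  then show "sh a b = sh b a"
    by (induct a rule: word_induct) (simp_all add: sh_linear_right 1 2)
qed

lemma sh_one [simp]: "sh 1 a = a" "sh a 1 = a"
proof -
  show "sh 1 a = a" for a
    by (induct a rule: word_induct) (simp_all add: sh_linear_right sh_word_word[of "[]", simplified])
  then show "sh a 1 = a" by (metis sh_commute)
qed

lemma sh_letter: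
  "sh (\<iota> x * u) (\<iota> y * v) = \<iota> x * sh u (\<iota> y * v) + \<iota> y * sh (\<iota> x * u) v"
proof -
  have w: "sh (\<iota> x * word xs) (\<iota> y * word ys)
      = \<iota> x * sh (word xs) (\<iota> y * word ys) + \<iota> y * sh (\<iota> x * word xs) (word ys)" for xs ys
    using sh_word_word[of "x # xs" "y # ys"] sh_word_word[of "x # xs" ys] sh_word_word[of xs "y # ys"]
    by simp
  have "sh (\<iota> x * u) (\<iota> y * word ys)
      = \<iota> x * sh u (\<iota> y * word ys) + \<iota> y * sh (\<iota> x * u) (word ys)" for ys
    by (induct u rule: word_induct)
      (simp_all add: w sh_linear_left sh_linear_right scale_mult distrib_left T.scale_right_distrib)
  then show ?thesis
    by (induct v rule: word_induct)
      (simp_all add: sh_linear_left sh_linear_right scale_mult distrib_left T.scale_right_distrib)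
qed

lemmas sh_linear = sh_linear_left sh_linear_right

lemma bilinear_sh: "bilinear_map sT sT sT sh"
  by (rule bilinear_mapI) (simp_all add: sh_linear vs_T)

lemma sh_zero [simp]: "sh 0 a = 0" "sh a 0 = 0"
  using bilinear_map_zero[OF bilinear_sh] by auto

lemma shuffle_eq_sh: "shuffle sT \<iota> = sh"
  unfolding shuffle_def
proof (rule the_equality, safe)
  show "bilinear_map sT sT sT sh" by (rule bilinear_sh)
  fix s' :: "'t \<Rightarrow> 't \<Rightarrow> 't"
  assume b: "bilinear_map sT sT sT s'" and l: "\<forall>w. s' 1 w = w" and r: "\<forall>w. s' w 1 = w"
    and rec: "\<forall>x y u v. s' (\<iota> x * u) (\<iota> y * v) = \<iota> x * s' u (\<iota> y * v) + \<iota> y * s' (\<iota> x * u) v"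
  note [simp] = bilinear_mapD[OF b]
  have "s' u v = sh u v" for u v
  proof (induct u arbitrary: v rule: T_induct)
    case (letter x u)
    note IH = letter
    show ?case
      by (induct v rule: T_induct) (simp_all add: r rec sh_letter sh_linear IH)
  qed (simp_all add: l sh_linear)
  then show "s' = sh" by blast
qed (simp_all add: sh_letter)

text \<open>The first letter of a word in a triple shuffle is the first letter of one of the three factors;
  stripping it leaves the same identity with that factor shortened, for either bracketing.\<close>

lemma sh_assoc: "sh (sh a b) c = sh a (sh b c)"
proof (induct a arbitrary: b c rule: T_induct)
  case (letter x u)
  note IHa = letter
  show ?case
  proof (induct b arbitrary: c rule: T_induct)
    case (letter y v)
    note IHb = letter
    show ?case
    proof (induct c rule: T_induct)
      case (letter z w)
      have "sh (sh (\<iota> x * u) (\<iota> y * v)) (\<iota> z * w) =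
          \<iota> x * sh (sh u (\<iota> y * v)) (\<iota> z * w) + \<iota> y * sh (sh (\<iota> x * u) v) (\<iota> z * w)
          + \<iota> z * sh (sh (\<iota> x * u) (\<iota> y * v)) w"
        by (simp add: sh_letter sh_linear distrib_left)
      also have "\<dots> = \<iota> x * sh u (sh (\<iota> y * v) (\<iota> z * w)) + \<iota> y * sh (\<iota> x * u) (sh v (\<iota> z * w))
          + \<iota> z * sh (\<iota> x * u) (sh (\<iota> y * v) w)"
        by (simp add: IHa IHb letter)
      also have "\<dots> = sh (\<iota> x * u) (sh (\<iota> y * v) (\<iota> z * w))"
        by (simp add: sh_letter sh_linear distrib_left)
      finally show ?case .
    qed (simp_all add: sh_linear)
  qed (simp_all add: sh_linear)
qed (simp_all add: sh_linear)

lemma sh_right_commute: "sh (sh t a) b = sh (sh t b) a"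
  by (simp add: sh_assoc sh_commute[of a b])

end

section \<open>The pre-Lie product on words\<close>

locale word_prelie = tensor_alg sV sT \<iota>
  for sV :: "'k::field \<Rightarrow> 'v::ab_group_add \<Rightarrow> 'v"
    and sT :: "'k \<Rightarrow> 't::ring_1 \<Rightarrow> 't" and \<iota> +
  fixes f :: "'v \<Rightarrow> 'v"
  assumes linear_f: "Vector_Spaces.linear sV sV f"
begin

lemmas f_linear = linearD[OF linear_f]

fun word_pl :: "'t \<Rightarrow> 'v list \<Rightarrow> 't" where
  "word_pl w' [] = 0"
| "word_pl w' (x # xs) = \<iota> x * word_pl w' xs + \<iota> (f x) * sh (word xs) w'"

lemma multilinear_word_pl: "multilinear sT (word_pl w')"
proof (rule multilinearI)
  show "word_pl w' (u @ (x + y) # v) = word_pl w' (u @ x # v) + word_pl w' (u @ y # v)" for u x y v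
    by (induct u)
      (simp_all add: f_linear iota_add sh_linear word_multilinear algebra_simps
        del: map_append prod_list.append)
  show "word_pl w' (u @ sV c x # v) = sT c (word_pl w' (u @ x # v))" for u c x v
    by (induct u)
      (simp_all add: f_linear iota_scale sh_linear word_multilinear scale_mult
        T.scale_right_distrib del: map_append prod_list.append)
qed

definition pl :: "'t \<Rightarrow> 't \<Rightarrow> 't" where
  "pl w w' = lift_T sT (word_pl w') w"

lemma pl_linear_left: "pl (a + b) w = pl a w + pl b w" "pl (sT c a) w = sT c (pl a w)"
  and pl_word: "pl (word xs) w = word_pl w xs"
  by (simp_all add: pl_def lift_T_simps[OF vs_T multilinear_word_pl])

lemma pl_one [simp]: "pl 1 w = 0"
  using pl_word[of "[]"] by simp

lemma pl_letter: "pl (\<iota> x * w) w' = \<iota> x * pl w w' + \<iota> (f x) * sh w w'"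
proof (induct w rule: word_induct)
  case (word xs)
  show ?case using pl_word[of "x # xs" w'] by (simp add: pl_word)
qed (simp_all add: pl_linear_left sh_linear scale_mult distrib_left T.scale_right_distrib)

lemma pl_linear_right: "pl w (a + b) = pl w a + pl w b" "pl w (sT c a) = sT c (pl w a)"
proof -
  show "pl w (a + b) = pl w a + pl w b"
    by (induct w rule: T_induct)
      (simp_all add: pl_letter pl_linear_left sh_linear distrib_left T.scale_right_distrib)
  show "pl w (sT c a) = sT c (pl w a)"
    by (induct w rule: T_induct)
      (simp_all add: pl_letter pl_linear_left sh_linear scale_mult T.scale_right_distrib mult.commute)
qed

lemmas pl_linear = pl_linear_left pl_linear_right

lemma bilinear_pl: "bilinear_map sT sT sT pl"
  by (rule bilinear_mapI) (simp_all add: pl_linear vs_T)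

lemma prelie_eq_pl: "prelie sT \<iota> f = pl"
  unfolding prelie_def shuffle_eq_sh
proof (rule the_equality, safe)
  show "bilinear_map sT sT sT pl" by (rule bilinear_pl)
  fix b :: "'t \<Rightarrow> 't \<Rightarrow> 't"
  assume b: "bilinear_map sT sT sT b" and one: "\<forall>w'. b 1 w' = 0"
    and rec: "\<forall>x w w'. b (\<iota> x * w) w' = \<iota> x * b w w' + \<iota> (f x) * sh w w'"
  have "b u v = pl u v" for u v
    by (induct u rule: T_induct)
      (simp_all add: bilinear_mapD[OF b] one rec pl_letter pl_linear)
  then show "b = pl" by blast
qed (simp_all add: pl_letter)

text \<open>Right multiplication by \<open>v\<close> is a derivation of the shuffle algebra: it sums, over the letters of a
  word, the results of applying \<open>f\<close> to that letter and shuffling \<open>v\<close> into what follows it, and each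
  letter of a shuffle comes from one of the two shuffled words.\<close>

lemma pl_sh: "pl (sh a b) v = sh (pl a v) b + sh a (pl b v)"
proof (induct a arbitrary: b rule: T_induct)
  case (letter x u)
  note IHa = letter
  show ?case
  proof (induct b rule: T_induct)
    case (letter y w)
    show ?case
      by (simp add: sh_letter pl_letter pl_linear IHa letter sh_linear distrib_left
          sh_assoc sh_commute[of v])
  qed (simp_all add: sh_linear pl_linear T.scale_right_distrib)
qed (simp_all add: sh_linear pl_linear T.scale_right_distrib)

end

section \<open>The symmetric algebra and its coproduct\<close>

lemma vector_space_mult: "vector_space ((*) :: 'k::field \<Rightarrow> 'k \<Rightarrow> 'k)"
  by unfold_locales (simp_all add: algebra_simps)

locale symmetric_alg =
  fixes sW :: "'k::field \<Rightarrow> 'w::ab_group_add \<Rightarrow> 'w"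
    and sS :: "'k \<Rightarrow> 's::comm_ring_1 \<Rightarrow> 's" and j :: "'w \<Rightarrow> 's"
  assumes symmetric_algebra: "symmetric_algebra sW sS j"
begin

lemma vs_W: "vector_space sW" and vs_S: "vector_space sS"
  and bilinear_S_mult: "bilinear_map sS sS sS (*)"
  and presented_S: "presented sS (\<lambda>M. \<Prod>a\<in>#M. j a) (symmetric_relations sW)"
  using symmetric_algebra by (auto simp: symmetric_algebra_def algebra_over_def)

sublocale W: vector_space sW by (rule vs_W)
sublocale S: vector_space sS by (rule vs_S)

abbreviation mono :: "'w multiset \<Rightarrow> 's" where "mono M \<equiv> \<Prod>a\<in>#M. j a"

lemma S_scale_mult: "sS c a * b = sS c (a * b)" "a * sS c b = sS c (a * b)"
  using bilinear_mapD[OF bilinear_S_mult] by auto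

definition sym_multilinear :: "('k \<Rightarrow> 'x::ab_group_add \<Rightarrow> 'x) \<Rightarrow> ('w multiset \<Rightarrow> 'x) \<Rightarrow> bool" where
  "sym_multilinear sX G \<longleftrightarrow>
     (\<forall>a b M. G (add_mset (a + b) M) = G (add_mset a M) + G (add_mset b M)) \<and>
     (\<forall>c a M. G (add_mset (sW c a) M) = sX c (G (add_mset a M)))"

lemma sym_multilinearI:
  assumes "\<And>a b M. G (add_mset (a + b) M) = G (add_mset a M) + G (add_mset b M)"
    and "\<And>c a M. G (add_mset (sW c a) M) = sX c (G (add_mset a M))"
  shows "sym_multilinear sX G"
  using assms by (auto simp: sym_multilinear_def)

lemma symmetric_relations_vanish_iff:
  fixes sX :: "'k \<Rightarrow> 'x::ab_group_add \<Rightarrow> 'x"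
  assumes "vector_space sX"
  shows "(\<forall>r\<in>symmetric_relations sW. lin_ext sX G r = 0) \<longleftrightarrow> sym_multilinear sX G"
proof -
  interpret X: vector_space sX by fact
  have d: "a - b = c \<longleftrightarrow> a = b + c" for a b c :: 'x
    by (auto simp: algebra_simps)
  show ?thesis
    unfolding symmetric_relations_def ball_Un sym_multilinear_def ball_Collect_ex
    by (simp add: lin_ext_diff[OF assms] lin_ext_single[OF assms] d)
qed

lemma sym_multilinear_mono: "sym_multilinear sS mono"
  using symmetric_relations_vanish_iff[OF vs_S] presented_relation[OF presented_S] by blast

lemma j_linear: "j (a + b) = j a + j b" "j (sW c a) = sS c (j a)"
proof -
  have "mono (add_mset (a + b) {#}) = mono (add_mset a {#}) + mono (add_mset b {#})"
    and "mono (add_mset (sW c a) {#}) = sS c (mono (add_mset a {#}))"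
    using sym_multilinear_mono unfolding sym_multilinear_def by blast+
  then show "j (a + b) = j a + j b" "j (sW c a) = sS c (j a)" by simp_all
qed

lemma j_0: "j 0 = 0" and j_diff: "j (a - b) = j a - j b" and j_sum: "j (sum g K) = (\<Sum>i\<in>K. j (g i))"
proof -
  show 0: "j 0 = 0" using j_linear(1)[of 0 0] by simp
  show "j (a - b) = j a - j b" using j_linear(1)[of "a - b" b] by simp
  show "j (sum g K) = (\<Sum>i\<in>K. j (g i))"
    by (induct K rule: infinite_finite_induct) (simp_all add: 0 j_linear)
qed

lemma S_induct [case_names one letter add scale]:
  assumes "P 1" "\<And>z a. P z \<Longrightarrow> P (z * j a)"
    and "\<And>y z. P y \<Longrightarrow> P z \<Longrightarrow> P (y + z)" "\<And>c z. P z \<Longrightarrow> P (sS c z)"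
  shows "P z"
proof (rule presented_induct[OF presented_S vs_S])
  show "P (mono M)" for M
    by (induct M) (auto simp: mult.commute[of "j _"] intro: assms)
qed (use assms in auto)

abbreviation lift_S where "lift_S \<equiv> lift_presented sS mono"

lemma
  assumes "vector_space sX" "sym_multilinear sX G"
  shows linear_lift_S: "Vector_Spaces.linear sS sX (lift_S sX G)"
    and lift_S_mono: "lift_S sX G (mono M) = G M"
proof -
  have R: "lin_ext sX G r = 0" if "r \<in> symmetric_relations sW" for r
    using that symmetric_relations_vanish_iff assms by blast
  show "Vector_Spaces.linear sS sX (lift_S sX G)" "lift_S sX G (mono M) = G M"
    using lift_presented[OF presented_S vs_S assms(1) R] by auto
qed

lemma lift_S_simps:
  assumes "vector_space sX" "sym_multilinear sX G"
  shows "lift_S sX G (a + b) = lift_S sX G a + lift_S sX G b"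
    and "lift_S sX G (sS c a) = sX c (lift_S sX G a)"
    and "lift_S sX G (mono M) = G M"
  using linearD[OF linear_lift_S[OF assms]] lift_S_mono[OF assms] by auto

lemma mono_induct [case_names mono add scale]:
  assumes "\<And>M. P (mono M)"
    and "\<And>a b. P a \<Longrightarrow> P b \<Longrightarrow> P (a + b)" "\<And>c a. P a \<Longrightarrow> P (sS c a)"
  shows "P z"
  by (rule presented_induct[OF presented_S vs_S]) (use assms in auto)

text \<open>The projection of \<open>S(W)\<close> onto its part of degree one is a left inverse of \<open>j\<close>.\<close>

lemma inj_j: "inj j"
proof -
  define G where "G M = (if size M = 1 then \<Sum>\<^sub># M else 0)" for M :: "'w multiset"
  have "sym_multilinear sW G"
    by (rule sym_multilinearI) (auto simp: G_def)
  then have "lift_S sW G (j a) = a" for a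
    using lift_S_simps(3)[OF vs_W, of G "{#a#}"] by (simp add: G_def)
  then show ?thesis by (metis injI)
qed

definition eps :: "'s \<Rightarrow> 'k" where
  "eps = lift_S (*) (\<lambda>M. if M = {#} then 1 else 0)"

lemma eps_linear: "eps (a + b) = eps a + eps b" "eps (sS c a) = c * eps a"
  and eps_mono: "eps (mono M) = (if M = {#} then 1 else 0)"
proof -
  have "sym_multilinear (*) (\<lambda>M. if M = {#} then 1 else 0 :: 'k)"
    by (rule sym_multilinearI) auto
  note [simp] = lift_S_simps[OF vector_space_mult this]
  show "eps (a + b) = eps a + eps b" "eps (sS c a) = c * eps a"
     "eps (mono M) = (if M = {#} then 1 else 0)"
    by (simp_all add: eps_def)
qed

lemma eps_one [simp]: "eps 1 = 1"
  using eps_mono[of "{#}"] by simp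

lemma eps_mult_j [simp]: "eps (z * j a) = 0"
proof (induct z rule: mono_induct)
  case (mono M)
  show ?case using eps_mono[of "add_mset a M"] by (simp add: mult.commute)
qed (simp_all add: eps_linear distrib_right S_scale_mult)

lemma eps_j [simp]: "eps (j a) = 0"
  using eps_mult_j[of 1 a] by simp

lemma eps_mult: "eps (y * z) = eps y * eps z"
  by (induct z rule: S_induct)
    (simp_all add: eps_linear distrib_left S_scale_mult mult.assoc[symmetric])

lemma counit_eq_eps: "counit sS j = eps"
  unfolding counit_def
proof (rule the_equality)
  show "algebra_hom sS (*) eps \<and> (\<forall>a. eps (j a) = 0)"
    using vs_S vector_space_mult
    by (simp add: algebra_hom_def Vector_Spaces.linear_iff eps_linear eps_mult)
  fix e assume e: "algebra_hom sS (*) e \<and> (\<forall>a. e (j a) = 0)"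
  have "e z = eps z" for z
    by (induct z rule: S_induct)
      (use e in \<open>simp_all add: algebra_hom_def Vector_Spaces.linear_iff eps_linear\<close>)
  then show "e = eps" by blast
qed

end

locale symmetric_coalg = symmetric_alg sW sS j
  for sW :: "'k::field \<Rightarrow> 'w::ab_group_add \<Rightarrow> 'w"
    and sS :: "'k \<Rightarrow> 's::comm_ring_1 \<Rightarrow> 's" and j +
  fixes sSS :: "'k \<Rightarrow> 'ss::ring_1 \<Rightarrow> 'ss" and tns :: "'s \<Rightarrow> 's \<Rightarrow> 'ss"
  assumes tensor_square: "tensor_square sS sSS tns"
begin

lemma vs_SS: "vector_space sSS"
  and bilinear_SS_mult: "bilinear_map sSS sSS sSS (*)"
  and presented_SS: "presented sSS (\<lambda>(a, b). tns a b) (tensor_square_relations sS)"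
  and tns_one: "tns 1 1 = 1"
  and tns_mult: "tns a b * tns c d = tns (a * c) (b * d)"
  using tensor_square by (auto simp: tensor_square_def algebra_over_def)

sublocale SS: vector_space sSS by (rule vs_SS)

lemma SS_scale_mult: "sSS c a * b = sSS c (a * b)" "a * sSS c b = sSS c (a * b)"
  using bilinear_mapD[OF bilinear_SS_mult] by auto

lemma tensor_square_relations_vanish_iff:
  fixes sX :: "'k \<Rightarrow> 'x::ab_group_add \<Rightarrow> 'x"
  assumes "vector_space sX"
  shows "(\<forall>r\<in>tensor_square_relations sS. lin_ext sX (\<lambda>(a, b). h a b) r = 0)
    \<longleftrightarrow> bilinear_map sS sS sX h"
proof -
  interpret X: vector_space sX by fact
  have d: "a - b = c \<longleftrightarrow> a = b + c" for a b c :: 'x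
    by (auto simp: algebra_simps)
  show ?thesis
    unfolding tensor_square_relations_def ball_Un bilinear_map_def Vector_Spaces.linear_iff
      ball_Collect_ex
    using vs_S assms by (auto simp: lin_ext_diff[OF assms] lin_ext_single[OF assms] d)
qed

lemma bilinear_tns: "bilinear_map sS sS sSS tns"
  using tensor_square_relations_vanish_iff[OF vs_SS] presented_relation[OF presented_SS] by blast

lemmas tns_linear = bilinear_mapD[OF bilinear_tns]

lemma SS_induct [case_names tns add scale]:
  assumes "\<And>a b. P (tns a b)"
    and "\<And>a b. P a \<Longrightarrow> P b \<Longrightarrow> P (a + b)" "\<And>c a. P a \<Longrightarrow> P (sSS c a)"
  shows "P z"
  by (rule presented_induct[OF presented_SS vs_SS]) (use assms in \<open>auto split: prod.splits\<close>)

lemma SS_mult_commute: "y * z = z * (y :: 'ss)"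
proof -
  have "tns a b * z = z * tns a b" for a b
    by (induct z rule: SS_induct)
      (simp_all add: tns_mult mult.commute distrib_left distrib_right SS_scale_mult)
  then show ?thesis
    by (induct y rule: SS_induct) (simp_all add: distrib_left distrib_right SS_scale_mult)
qed

abbreviation bilinear_S :: "('k \<Rightarrow> 'x::ab_group_add \<Rightarrow> 'x) \<Rightarrow> ('s \<Rightarrow> 's \<Rightarrow> 'x) \<Rightarrow> bool" where
  "bilinear_S sX \<equiv> bilinear_map sS sS sX"

text \<open>The linear map on \<open>S(W) \<otimes> S(W)\<close> that a bilinear map induces.\<close>

definition tlift :: "('k \<Rightarrow> 'x::ab_group_add \<Rightarrow> 'x) \<Rightarrow> ('s \<Rightarrow> 's \<Rightarrow> 'x) \<Rightarrow> 'ss \<Rightarrow> 'x" where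
  "tlift sX h = lift_presented sSS (\<lambda>(a, b). tns a b) sX (\<lambda>(a, b). h a b)"

lemma
  assumes "vector_space sX" "bilinear_S sX h"
  shows linear_tlift: "Vector_Spaces.linear sSS sX (tlift sX h)"
    and tlift_tns: "tlift sX h (tns a b) = h a b"
proof -
  have R: "lin_ext sX (\<lambda>(a, b). h a b) r = 0" if "r \<in> tensor_square_relations sS" for r
    using that tensor_square_relations_vanish_iff assms by blast
  show "Vector_Spaces.linear sSS sX (tlift sX h)" "tlift sX h (tns a b) = h a b"
    using lift_presented(1)[OF presented_SS vs_SS assms(1) R]
      lift_presented(2)[OF presented_SS vs_SS assms(1) R, of "(a, b)"]
    by (auto simp: tlift_def)
qed

definition cop :: "'s \<Rightarrow> 'ss" where
  "cop = lift_S sSS (fold_mset (\<lambda>a t. (tns (j a) 1 + tns 1 (j a)) * t) 1)"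

lemma cop_linear: "cop (y + z) = cop y + cop z" "cop (sS c z) = sSS c (cop z)"
  and cop_one: "cop 1 = 1"
  and cop_mult_j: "cop (z * j a) = cop z * (tns (j a) 1 + tns 1 (j a))"
proof -
  let ?P = "\<lambda>a t. (tns (j a) 1 + tns 1 (j a)) * t"
  interpret comp_fun_commute ?P
    by unfold_locales (simp add: fun_eq_iff, metis mult.assoc SS_mult_commute)
  have "sym_multilinear sSS (fold_mset ?P 1)"
    by (rule sym_multilinearI; unfold fold_mset_add_mset)
      (simp_all add: j_linear tns_linear distrib_right add_ac SS_scale_mult SS.scale_right_distrib)
  note L = lift_S_simps[OF vs_SS this]
  show l: "cop (y + z) = cop y + cop z" "cop (sS c z) = sSS c (cop z)" for y z c
    by (simp_all add: cop_def L)
  show "cop 1 = 1" using L(3)[of "{#}"] by (simp add: cop_def)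
  have m: "cop (mono (add_mset a M)) = cop (mono M) * (tns (j a) 1 + tns 1 (j a))" for M
    unfolding cop_def L fold_mset_add_mset by (rule SS_mult_commute)
  show "cop (z * j a) = cop z * (tns (j a) 1 + tns 1 (j a))"
  proof (induct z rule: mono_induct)
    case (mono M)
    show ?case using m[of M] by (simp add: mult.commute[of "j a"])
  qed (simp_all add: l distrib_right S_scale_mult SS_scale_mult)
qed

lemma cop_mult: "cop (y * z) = cop y * cop z"
  by (induct z rule: S_induct)
    (simp_all add: cop_linear cop_one cop_mult_j distrib_left S_scale_mult SS_scale_mult
      mult.assoc[symmetric] del: distrib_left_numeral)

lemma coproduct_eq_cop: "coproduct sS j sSS tns = cop"
  unfolding coproduct_def
proof (rule the_equality)
  show "algebra_hom sS sSS cop \<and> (\<forall>a. cop (j a) = tns (j a) 1 + tns 1 (j a))"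
    using vs_S vs_SS cop_mult_j[of 1]
    by (simp add: algebra_hom_def Vector_Spaces.linear_iff cop_linear cop_mult cop_one)
  fix D assume D: "algebra_hom sS sSS D \<and> (\<forall>a. D (j a) = tns (j a) 1 + tns 1 (j a))"
  have "D z = cop z" for z
    by (induct z rule: S_induct)
      (use D in \<open>simp_all add: algebra_hom_def Vector_Spaces.linear_iff cop_linear cop_one cop_mult_j\<close>)
  then show "D = cop" by blast
qed

text \<open>The sum \<open>h (z\<^sup>(\<^sup>1\<^sup>)) (z\<^sup>(\<^sup>2\<^sup>))\<close>, with values in any vector space: besides \<open>S(W)\<close>, also
  \<open>T(V)\<close> is needed as a target.\<close>

definition sw :: "('k \<Rightarrow> 'x::ab_group_add \<Rightarrow> 'x) \<Rightarrow> ('s \<Rightarrow> 's \<Rightarrow> 'x) \<Rightarrow> 's \<Rightarrow> 'x" where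
  "sw sX h z = tlift sX h (cop z)"

lemma sweedler_eq_sw:
  assumes "bilinear_S sS h"
  shows "sweedler sS j sSS tns h z = sw sS h z"
proof -
  have "(THE L. Vector_Spaces.linear sSS sS L \<and> (\<forall>a b. L (tns a b) = h a b)) = tlift sS h"
  proof (rule the_equality)
    show "Vector_Spaces.linear sSS sS (tlift sS h) \<and> (\<forall>a b. tlift sS h (tns a b) = h a b)"
      using linear_tlift tlift_tns vs_S assms by blast
    fix L assume L: "Vector_Spaces.linear sSS sS L \<and> (\<forall>a b. L (tns a b) = h a b)"
    have "L t = tlift sS h t" for t
      by (induct t rule: SS_induct)
        (use L linearD[of sSS sS L] in \<open>simp_all add: linearD[OF linear_tlift[OF vs_S assms]]
          tlift_tns[OF vs_S assms]\<close>)
    then show "L = tlift sS h" by blast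
  qed
  then show ?thesis by (simp add: sweedler_def coproduct_eq_cop sw_def)
qed

context
  fixes sX :: "'k \<Rightarrow> 'x::ab_group_add \<Rightarrow> 'x"
  assumes vs_X: "vector_space sX"
begin

interpretation X: vector_space sX by (rule vs_X)

lemma sw_linear:
  assumes "bilinear_S sX h"
  shows "sw sX h (y + z) = sw sX h y + sw sX h z" "sw sX h (sS c z) = sX c (sw sX h z)"
  by (simp_all add: sw_def cop_linear linearD[OF linear_tlift[OF vs_X assms]])

lemma sw_one: "bilinear_S sX h \<Longrightarrow> sw sX h 1 = h 1 1"
  by (simp add: sw_def cop_one tns_one[symmetric] tlift_tns vs_X)

lemma bilinear_shift:
  assumes "bilinear_S sX h"
  shows "bilinear_S sX (\<lambda>a b. h (a * u) b)" "bilinear_S sX (\<lambda>a b. h a (b * u))"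
  using vs_S vs_X bilinear_mapD[OF assms]
  by (auto intro!: bilinear_mapI simp: distrib_right S_scale_mult)

lemma bilinear_swap: "bilinear_S sX h \<Longrightarrow> bilinear_S sX (\<lambda>a b. h b a)"
  by (auto simp: bilinear_map_def)

text \<open>Together with linearity and the value at \<open>1\<close>, this recursion determines the Sweedler sum.\<close>

lemma sw_mult_j:
  assumes h: "bilinear_S sX h"
  shows "sw sX h (z * j v) = sw sX (\<lambda>a b. h (a * j v) b) z + sw sX (\<lambda>a b. h a (b * j v)) z"
proof -
  note [simp] = linearD[OF linear_tlift[OF vs_X h]] tlift_tns[OF vs_X h]
    linearD[OF linear_tlift[OF vs_X bilinear_shift(1)[OF h]]] tlift_tns[OF vs_X bilinear_shift(1)[OF h]]
    linearD[OF linear_tlift[OF vs_X bilinear_shift(2)[OF h]]] tlift_tns[OF vs_X bilinear_shift(2)[OF h]]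
  have "tlift sX h (t * (tns (j v) 1 + tns 1 (j v)))
      = tlift sX (\<lambda>a b. h (a * j v) b) t + tlift sX (\<lambda>a b. h a (b * j v)) t" for t
    by (induct t rule: SS_induct)
      (simp_all add: distrib_left[of "tns _ _"] tns_mult distrib_right[of _ _ "_ + _"] SS_scale_mult
        X.scale_right_distrib)
  then show ?thesis by (simp add: sw_def cop_mult_j)
qed

lemma sw_add:
  assumes "bilinear_S sX h" "bilinear_S sX h'"
  shows "sw sX (\<lambda>a b. h a b + h' a b) z = sw sX h z + sw sX h' z"
proof -
  have s: "bilinear_S sX (\<lambda>a b. h a b + h' a b)"
    using vs_S vs_X bilinear_mapD[OF assms(1)] bilinear_mapD[OF assms(2)]
    by (auto intro!: bilinear_mapI simp: algebra_simps X.scale_right_distrib)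
  note [simp] = linearD[OF linear_tlift[OF vs_X s]] tlift_tns[OF vs_X s]
    linearD[OF linear_tlift[OF vs_X assms(1)]] tlift_tns[OF vs_X assms(1)]
    linearD[OF linear_tlift[OF vs_X assms(2)]] tlift_tns[OF vs_X assms(2)]
  have "tlift sX (\<lambda>a b. h a b + h' a b) t = tlift sX h t + tlift sX h' t" for t
    by (induct t rule: SS_induct) (simp_all add: X.scale_right_distrib)
  then show ?thesis by (simp add: sw_def)
qed

lemma sw_scale:
  assumes "bilinear_S sX h"
  shows "sw sX (\<lambda>a b. sX c (h a b)) z = sX c (sw sX h z)"
proof -
  have s: "bilinear_S sX (\<lambda>a b. sX c (h a b))"
    using vs_S vs_X bilinear_mapD[OF assms(1)]
    by (auto intro!: bilinear_mapI simp: X.scale_right_distrib mult.commute)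
  note [simp] = linearD[OF linear_tlift[OF vs_X s]] tlift_tns[OF vs_X s]
    linearD[OF linear_tlift[OF vs_X assms(1)]] tlift_tns[OF vs_X assms(1)]
  have "tlift sX (\<lambda>a b. sX c (h a b)) t = sX c (tlift sX h t)" for t
    by (induct t rule: SS_induct) (simp_all add: X.scale_right_distrib mult.commute)
  then show ?thesis by (simp add: sw_def)
qed

lemma sw_swap: "bilinear_S sX h \<Longrightarrow> sw sX h z = sw sX (\<lambda>a b. h b a) z"
proof (induct z arbitrary: h rule: S_induct)
  case (letter z v)
  note h = letter(2)
  show ?case
    unfolding sw_mult_j[OF h] sw_mult_j[OF bilinear_swap[OF h]]
      letter(1)[OF bilinear_shift(1)[OF h]] letter(1)[OF bilinear_shift(2)[OF h]]
    by (rule add.commute)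
next
  case one
  then show ?case by (simp add: sw_one[OF one] sw_one[OF bilinear_swap[OF one]])
next
  case (add y z)
  then show ?case by (simp add: sw_linear[OF add(3)] sw_linear[OF bilinear_swap[OF add(3)]])
next
  case (scale c z)
  then show ?case by (simp add: sw_linear[OF scale(2)] sw_linear[OF bilinear_swap[OF scale(2)]])
qed

end

end

section \<open>Convolution\<close>

context symmetric_coalg
begin

lemma sw_image:
  assumes X: "vector_space sX" and h: "bilinear_S sX h" and L: "Vector_Spaces.linear sX sY L"
  shows "L (sw sX h z) = sw sY (\<lambda>a b. L (h a b)) z"
proof -
  have Y: "vector_space sY" using L by (simp add: Vector_Spaces.linear_iff)
  have b: "bilinear_S sY (\<lambda>a b. L (h a b))"
    using vs_S Y bilinear_mapD[OF h] linearD[OF L] by (auto intro!: bilinear_mapI)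
  have "L (tlift sX h t) = tlift sY (\<lambda>a b. L (h a b)) t" for t
    by (induct t rule: SS_induct)
      (simp_all add: tlift_tns[OF X h] tlift_tns[OF Y b] linearD[OF linear_tlift[OF X h]]
        linearD[OF linear_tlift[OF Y b]] linearD[OF L])
  then show ?thesis by (simp add: sw_def)
qed

context
  fixes sX :: "'k \<Rightarrow> 'x::ab_group_add \<Rightarrow> 'x"
  assumes vs_X: "vector_space sX"
begin

interpretation X: vector_space sX by (rule vs_X)

lemma sw_zero: "sw sX (\<lambda>a b. 0) z = 0"
proof -
  have "bilinear_S sX (\<lambda>a b. 0)" using vs_S vs_X by (auto intro!: bilinear_mapI)
  from sw_scale[OF vs_X this, of 0 z] show ?thesis by simp
qed

lemma sw_counit:
  assumes F: "Vector_Spaces.linear sS sX F"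
  shows "sw sX (\<lambda>a b. sX (eps a) (F b)) z = F z"
proof -
  have b: "bilinear_S sX (\<lambda>a b. sX (eps a) (F b))" if "Vector_Spaces.linear sS sX F" for F
    using vs_S vs_X linearD[OF that]
    by (auto intro!: bilinear_mapI simp: eps_linear X.scale_left_distrib X.scale_right_distrib mult.commute)
  show ?thesis
    using F
  proof (induct z arbitrary: F rule: S_induct)
    case (letter z v)
    have "Vector_Spaces.linear sS sX (\<lambda>b. F (b * j v))"
      using vs_S vs_X linearD[OF letter(2)] by (simp add: Vector_Spaces.linear_iff distrib_right S_scale_mult)
    from letter(1)[OF this] show ?case
      by (simp add: sw_mult_j[OF vs_X b[OF letter(2)]] sw_zero)
  next
    case one
    then show ?case by (simp add: sw_one[OF vs_X b])
  next
    case (add y z)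
    then show ?case by (simp add: sw_linear[OF vs_X b] linearD)
  next
    case (scale c z)
    then show ?case by (simp add: sw_linear[OF vs_X b] linearD)
  qed
qed

definition trilinear_S :: "('s \<Rightarrow> 's \<Rightarrow> 's \<Rightarrow> 'x) \<Rightarrow> bool" where
  "trilinear_S t \<longleftrightarrow> (\<forall>a. bilinear_S sX (t a)) \<and> (\<forall>c. bilinear_S sX (\<lambda>a b. t a b c))"

lemma trilinear_SD:
  assumes "trilinear_S t"
  shows "t (a + a') b c = t a b c + t a' b c" "t (sS k a) b c = sX k (t a b c)"
    and "t a (b + b') c = t a b c + t a b' c" "t a (sS k b) c = sX k (t a b c)"
    and "t a b (c + c') = t a b c + t a b c'" "t a b (sS k c) = sX k (t a b c)"
  using assms bilinear_mapD[of sS sS sX "t a"] bilinear_mapD[of sS sS sX "\<lambda>a b. t a b c"]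
  unfolding trilinear_S_def by blast+

lemma trilinear_SI:
  assumes "\<And>a a' b c. t (a + a') b c = t a b c + t a' b c" "\<And>k a b c. t (sS k a) b c = sX k (t a b c)"
    and "\<And>a b b' c. t a (b + b') c = t a b c + t a b' c" "\<And>k a b c. t a (sS k b) c = sX k (t a b c)"
    and "\<And>a b c c'. t a b (c + c') = t a b c + t a b c'" "\<And>k a b c. t a b (sS k c) = sX k (t a b c)"
  shows "trilinear_S t"
  unfolding trilinear_S_def using vs_S vs_X assms by (auto intro!: bilinear_mapI)

lemma bilinear_sw_inner:
  assumes t: "trilinear_S t"
  shows "bilinear_S sX (\<lambda>a z. sw sX (t a) z)"
proof -
  have b: "bilinear_S sX (t a)" for a using t by (auto simp: trilinear_S_def)
  have "t (a + a') = (\<lambda>b c. t a b c + t a' b c)" "t (sS k a) = (\<lambda>b c. sX k (t a b c))" for a a' k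
    by (simp_all add: fun_eq_iff trilinear_SD[OF t])
  then show ?thesis
    using vs_S vs_X
    by (auto intro!: bilinear_mapI simp: sw_add[OF vs_X b b] sw_scale[OF vs_X b] sw_linear[OF vs_X b])
qed

text \<open>Coassociativity and cocommutativity in one identity:
  \<open>t(z\<^sup>(\<^sup>1\<^sup>), z\<^sup>(\<^sup>2\<^sup>), z\<^sup>(\<^sup>3\<^sup>))\<close> is invariant under
  exchanging the first two tensor factors.\<close>

lemma sw_left_commute:
  assumes "trilinear_S t"
  shows "sw sX (\<lambda>a z. sw sX (\<lambda>b c. t a b c) z) z = sw sX (\<lambda>b z. sw sX (\<lambda>a c. t a b c) z) z"
proof -
  have swap: "trilinear_S (\<lambda>b a c. t a b c)" if "trilinear_S t" for t
    using trilinear_SD[OF that] by (intro trilinear_SI)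
  show ?thesis
    using assms
  proof (induct z arbitrary: t rule: S_induct)
    case (letter z v)
    note t = letter(2)
    note D = trilinear_SD[OF t]
    have t1: "trilinear_S (\<lambda>a b c. t (a * j v) b c)"
      and t2: "trilinear_S (\<lambda>a b c. t a (b * j v) c)"
      and t3: "trilinear_S (\<lambda>a b c. t a b (c * j v))"
      by (intro trilinear_SI; simp add: D distrib_right S_scale_mult)+
    have expand: "sw sX (\<lambda>a z. sw sX (\<lambda>b c. t a b c) z) (z * j v) =
        sw sX (\<lambda>a z. sw sX (\<lambda>b c. t (a * j v) b c) z) z
        + (sw sX (\<lambda>a z. sw sX (\<lambda>b c. t a (b * j v) c) z) z
        + sw sX (\<lambda>a z. sw sX (\<lambda>b c. t a b (c * j v)) z) z)" if "trilinear_S t" for t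
    proof -
      note D = trilinear_SD[OF that]
      have t2: "trilinear_S (\<lambda>a b c. t a (b * j v) c)"
        and t3: "trilinear_S (\<lambda>a b c. t a b (c * j v))"
        by (intro trilinear_SI; simp add: D distrib_right S_scale_mult)+
      have b: "bilinear_S sX (t a)" for a using that by (auto simp: trilinear_S_def)
      show ?thesis
        unfolding sw_mult_j[OF vs_X bilinear_sw_inner[OF that]] sw_mult_j[OF vs_X b]
          sw_add[OF vs_X bilinear_sw_inner[OF t2] bilinear_sw_inner[OF t3]] ..
    qed
    show ?case
      unfolding expand[OF t] expand[OF swap[OF t]] letter(1)[OF t1] letter(1)[OF t2] letter(1)[OF t3]
      by (simp add: add_ac)
  next
    case one
    have "bilinear_S sX (\<lambda>b c. t a b c)" "bilinear_S sX (\<lambda>a c. t a b c)" for a b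
      using one swap[OF one] by (auto simp: trilinear_S_def)
    then show ?case
      by (simp add: sw_one[OF vs_X] bilinear_sw_inner[OF one] bilinear_sw_inner[OF swap[OF one]])
  next
    case (add y z)
    then show ?case
      by (simp add: sw_linear(1)[OF vs_X bilinear_sw_inner[OF add(3)]]
          sw_linear(1)[OF vs_X bilinear_sw_inner[OF swap[OF add(3)]]])
  next
    case (scale k z)
    then show ?case
      by (simp add: sw_linear(2)[OF vs_X bilinear_sw_inner[OF scale(2)]]
          sw_linear(2)[OF vs_X bilinear_sw_inner[OF swap[OF scale(2)]]])
  qed
qed

text \<open>Each factor is primitive, so it goes to the left or to the right tensor factor.\<close>

lemma sw_prod:
  assumes "finite K" "bilinear_S sX h"
  shows "sw sX h (\<Prod>i\<in>K. j (g i)) = (\<Sum>I\<in>Pow K. h (\<Prod>i\<in>I. j (g i)) (\<Prod>i\<in>K - I. j (g i)))"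
  using assms
proof (induct K arbitrary: h rule: finite_induct)
  case empty
  then show ?case by (simp add: sw_one[OF vs_X])
next
  case (insert k K)
  let ?p = "\<lambda>I. \<Prod>i\<in>I. j (g i)"
  note h = insert(4)
  have "sw sX h (?p (insert k K)) = sw sX (\<lambda>a b. h (a * j (g k)) b) (?p K) + sw sX (\<lambda>a b. h a (b * j (g k))) (?p K)"
    using insert(1,2) by (simp add: mult.commute[of "j (g k)"] sw_mult_j[OF vs_X h])
  also have "\<dots> = (\<Sum>I\<in>Pow K. h (?p I * j (g k)) (?p (K - I))) + (\<Sum>I\<in>Pow K. h (?p I) (?p (K - I) * j (g k)))"
    by (simp only: insert(3)[OF bilinear_shift(1)[OF vs_X h]] insert(3)[OF bilinear_shift(2)[OF vs_X h]])
  also have "(\<Sum>I\<in>Pow K. h (?p I * j (g k)) (?p (K - I))) = (\<Sum>I\<in>insert k ` Pow K. h (?p I) (?p (insert k K - I)))"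
  proof -
    have inj: "inj_on (insert k) (Pow K)" using insert(2) by (auto simp: inj_on_def)
    have "?p (insert k I) = ?p I * j (g k)" "insert k K - insert k I = K - I" if "I \<in> Pow K" for I
    proof -
      have "finite I" "k \<notin> I" using that insert(1,2) finite_subset by auto
      then show "?p (insert k I) = ?p I * j (g k)" by (simp add: mult.commute)
      show "insert k K - insert k I = K - I" using insert(2) by auto
    qed
    then show ?thesis by (simp add: sum.reindex[OF inj])
  qed
  also have "(\<Sum>I\<in>Pow K. h (?p I) (?p (K - I) * j (g k))) = (\<Sum>I\<in>Pow K. h (?p I) (?p (insert k K - I)))"
  proof (rule sum.cong)
    fix I assume "I \<in> Pow K"
    then have "insert k K - I = insert k (K - I)" "k \<notin> K - I" "finite (K - I)"
      using insert(1,2) by auto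
    then show "h (?p I) (?p (K - I) * j (g k)) = h (?p I) (?p (insert k K - I))"
      by (simp add: mult.commute)
  qed simp
  also have "(\<Sum>I\<in>insert k ` Pow K. h (?p I) (?p (insert k K - I))) + (\<Sum>I\<in>Pow K. h (?p I) (?p (insert k K - I)))
      = (\<Sum>I\<in>Pow (insert k K). h (?p I) (?p (insert k K - I)))"
    unfolding Pow_insert using insert(1,2)
    by (subst sum.union_disjoint) (auto simp: add.commute)
  finally show ?case .
qed

end

abbreviation linear_S :: "('s \<Rightarrow> 's) \<Rightarrow> bool" where
  "linear_S \<equiv> Vector_Spaces.linear sS sS"

definition conv :: "('s \<Rightarrow> 's) \<Rightarrow> ('s \<Rightarrow> 's) \<Rightarrow> 's \<Rightarrow> 's" where
  "conv F G z = sw sS (\<lambda>a b. F a * G b) z"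

definition conv_unit :: "'s \<Rightarrow> 's" where
  "conv_unit z = sS (eps z) 1"

lemma bilinear_conv:
  assumes "linear_S F" "linear_S G"
  shows "bilinear_S sS (\<lambda>a b. F a * G b)"
  using vs_S linearD[OF assms(1)] linearD[OF assms(2)]
  by (auto intro!: bilinear_mapI simp: algebra_simps S_scale_mult)

lemma linear_conv: "linear_S F \<Longrightarrow> linear_S G \<Longrightarrow> linear_S (conv F G)"
  using vs_S by (simp add: Vector_Spaces.linear_iff[of sS sS "conv F G"] conv_def
      sw_linear[OF vs_S bilinear_conv])

lemma linear_conv_unit: "linear_S conv_unit"
  using vs_S by (simp add: Vector_Spaces.linear_iff conv_unit_def eps_linear S.scale_left_distrib)

lemma conv_commute: "linear_S F \<Longrightarrow> linear_S G \<Longrightarrow> conv F G = conv G F"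
  by (rule ext) (simp add: conv_def sw_swap[OF vs_S bilinear_conv] mult.commute)

lemma conv_unit_left: "linear_S F \<Longrightarrow> conv conv_unit F = F"
  unfolding conv_def conv_unit_def using sw_counit[OF vs_S, of F] by (simp add: S_scale_mult fun_eq_iff)

lemma conv_left_commute:
  assumes F: "linear_S F" and G: "linear_S G" and H: "linear_S H"
  shows "conv F (conv G H) = conv G (conv F H)"
proof
  fix z
  have mult: "linear_S ((*) y)" for y
    using vs_S by (simp add: Vector_Spaces.linear_iff distrib_left S_scale_mult)
  have t: "trilinear_S sS (\<lambda>a b c. F a * (G b * H c))"
    by (rule trilinear_SI[OF vs_S])
      (simp_all add: linearD[OF F] linearD[OF G] linearD[OF H] algebra_simps S_scale_mult)
  have "conv F (conv G H) z = sw sS (\<lambda>a z. sw sS (\<lambda>b c. F a * (G b * H c)) z) z"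
    by (simp add: conv_def sw_image[OF vs_S bilinear_conv[OF G H] mult])
  also have "\<dots> = sw sS (\<lambda>b z. sw sS (\<lambda>a c. F a * (G b * H c)) z) z"
    by (rule sw_left_commute[OF vs_S t])
  also have "\<dots> = conv G (conv F H) z"
    by (simp add: conv_def sw_image[OF vs_S bilinear_conv[OF F H] mult] mult.left_commute)
  finally show "conv F (conv G H) z = conv G (conv F H) z" .
qed

lemma conv_add_right:
  assumes "linear_S F" "linear_S G" "linear_S H"
  shows "conv F (\<lambda>z. G z + H z) z = conv F G z + conv F H z"
  using sw_add[OF vs_S bilinear_conv[OF assms(1,2)] bilinear_conv[OF assms(1,3)]]
  by (simp add: conv_def distrib_left)

lemma conv_scale_right:
  assumes "linear_S F" "linear_S G"
  shows "conv F (\<lambda>z. sS c (G z)) z = sS c (conv F G z)"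
  using sw_scale[OF vs_S bilinear_conv[OF assms]]
  by (simp add: conv_def S_scale_mult)

section \<open>The Oudom--Guin extension\<close>

text \<open>The requirement \<open>(y \<times> y') \<bullet> z = (y \<bullet> z\<^sup>(\<^sup>1\<^sup>)) \<times> (y' \<bullet> z\<^sup>(\<^sup>2\<^sup>))\<close> says
  that \<open>y \<mapsto> (y \<bullet> _)\<close> is an algebra morphism into the linear endomorphisms of \<open>S(W)\<close> under
  convolution.  These form a commutative algebra, so the morphism exists for any prescribed values
  \<open>E u\<close> on generators.  The guard in the fold makes the folded operation commutative on all
  functions, not only on linear ones.\<close>

definition conv_ext :: "('w \<Rightarrow> 's \<Rightarrow> 's) \<Rightarrow> 's \<Rightarrow> 's \<Rightarrow> 's" where
  "conv_ext E y z = lift_S sS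
     (\<lambda>M. fold_mset (\<lambda>u F. if linear_S F then conv (E u) F else F) conv_unit M z) y"

context
  fixes E :: "'w \<Rightarrow> 's \<Rightarrow> 's"
  assumes E: "bilinear_map sW sS sS E"
begin

lemma linear_E: "linear_S (E u)"
  using E by (auto simp: bilinear_map_def)

lemma
  shows conv_ext_linear: "conv_ext E (y + y') z = conv_ext E y z + conv_ext E y' z"
      "conv_ext E (sS c y) z = sS c (conv_ext E y z)"
    and conv_ext_one: "conv_ext E 1 = conv_unit"
    and linear_conv_ext: "linear_S (conv_ext E y)"
    and conv_ext_mult_j: "conv_ext E (y * j u) = conv (E u) (conv_ext E y)"
proof -
  let ?P = "\<lambda>u F. if linear_S F then conv (E u) F else F"
  let ?B = "fold_mset ?P conv_unit"
  interpret comp_fun_commute ?P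
    by unfold_locales (auto simp: fun_eq_iff[of "_ \<circ> _"] conv_left_commute linear_E linear_conv)
  have lin: "linear_S (?B M)" for M
    by (induct M) (simp_all only: fold_mset_add_mset fold_mset_empty linear_conv_unit
        linear_conv[OF linear_E] if_True)
  have step: "?B (add_mset u M) = conv (E u) (?B M)" for u M
    unfolding fold_mset_add_mset by (simp only: lin if_True)
  have E_add: "conv (E (u + v)) F z = conv (E u) F z + conv (E v) F z"
    and E_scale: "conv (E (sW c u)) F z = sS c (conv (E u) F z)" if F: "linear_S F" for u v c F z
    using bilinear_mapD[OF E] sw_add[OF vs_S bilinear_conv[OF linear_E F] bilinear_conv[OF linear_E F], of u v z]
      sw_scale[OF vs_S bilinear_conv[OF linear_E F]]
    by (simp_all add: conv_def distrib_right S_scale_mult)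
  have "sym_multilinear sS (\<lambda>M. ?B M z)" for z
    by (rule sym_multilinearI) (simp_all only: step E_add[OF lin] E_scale[OF lin])
  note L = lift_S_simps[OF vs_S this]
  show l: "conv_ext E (y + y') z = conv_ext E y z + conv_ext E y' z"
      "conv_ext E (sS c y) z = sS c (conv_ext E y z)" for y y' z c
    by (simp_all only: conv_ext_def L)
  have m: "conv_ext E (mono M) = ?B M" for M
    by (rule ext) (simp only: conv_ext_def L)
  show "conv_ext E 1 = conv_unit"
    using m[of "{#}"] by simp
  have ll: "conv_ext E (y + y') = (\<lambda>z. conv_ext E y z + conv_ext E y' z)"
      "conv_ext E (sS c y) = (\<lambda>z. sS c (conv_ext E y z))" for y y' c
    by (auto simp: l)
  show lin': "linear_S (conv_ext E y)" for y
  proof (induct y rule: mono_induct)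
    case (mono M)
    show ?case by (simp only: m lin)
  next
    case (add y y')
    then show ?case by (auto simp: ll Vector_Spaces.linear_iff S.scale_right_distrib)
  next
    case (scale c y)
    then show ?case by (auto simp: ll Vector_Spaces.linear_iff S.scale_right_distrib mult.commute)
  qed
  show "conv_ext E (y * j u) = conv (E u) (conv_ext E y)"
  proof (induct y rule: mono_induct)
    case (mono M)
    have "mono M * j u = mono (add_mset u M)" by (simp add: mult.commute)
    then show ?case by (simp only: m step)
  next
    case (add y y')
    then show ?case by (simp add: distrib_right ll conv_add_right[OF linear_E lin' lin'] fun_eq_iff)
  next
    case (scale c y)
    then show ?case by (simp add: S_scale_mult ll conv_scale_right[OF linear_E lin'] fun_eq_iff)
  qed
qed

lemma bilinear_conv_ext: "bilinear_S sS (conv_ext E)"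
  by (rule bilinear_mapI) (simp_all add: vs_S conv_ext_linear linearD[OF linear_conv_ext])

lemma conv_ext_j: "conv_ext E (j u) = E u"
  using conv_ext_mult_j[of 1 u]
  by (simp add: conv_ext_one conv_commute[OF linear_E linear_conv_unit] conv_unit_left linear_E)

lemma conv_ext_mult: "conv_ext E (y * y') = conv (conv_ext E y) (conv_ext E y')"
proof (induct y' rule: S_induct)
  case one
  show ?case
    by (simp add: conv_ext_one conv_commute[OF linear_conv_ext linear_conv_unit] conv_unit_left
        linear_conv_ext)
next
  case (letter y' u)
  then show ?case
    by (simp add: mult.assoc[symmetric] conv_ext_mult_j conv_left_commute[OF linear_E linear_conv_ext linear_conv_ext])
next
  case (add y y')
  then show ?case
    by (simp add: distrib_left fun_eq_iff conv_ext_linear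
        conv_add_right[OF linear_conv_ext linear_conv_ext linear_conv_ext, symmetric])
next
  case (scale c y)
  then show ?case
    by (simp add: S_scale_mult fun_eq_iff conv_ext_linear
        conv_scale_right[OF linear_conv_ext linear_conv_ext, symmetric])
qed

end

text \<open>The recursion expresses \<open>u \<bullet> (U \<times> v)\<close> through \<open>u \<bullet> (U \<bullet> v)\<close>.  Here \<open>U \<bullet> v\<close> is no longer a
  product of generators, but it has the degree of \<open>U\<close>, so induction on the degree determines
  \<open>u \<bullet> z\<close>.  The part of degree \<open>n\<close> is \<open>homogeneous n\<close>.\<close>

definition homogeneous :: "nat \<Rightarrow> 's set" where
  "homogeneous n = S.span {prod_list (map j us) | us. length us = n}"

lemma homogeneous_mult_j:
  assumes "z \<in> homogeneous n"
  shows "z * j u \<in> homogeneous (Suc n)"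
  using assms unfolding homogeneous_def
proof (induct rule: S.span_induct_alt)
  case base
  show ?case by (simp add: S.span_zero)
next
  case (step c y z)
  then obtain us where us: "y = prod_list (map j us)" "length us = n" by auto
  have "y * j u = prod_list (map j (us @ [u]))" using us by simp
  then have "y * j u \<in> S.span {prod_list (map j us) | us. length us = Suc n}"
    using us(2) by (intro S.span_base) (metis (mono_tags, lifting) CollectI length_append_singleton)
  then show ?case
    using step by (simp add: distrib_right S_scale_mult S.span_add S.span_scale)
qed

lemma homogeneous_prod: "length us = n \<Longrightarrow> prod_list (map j us) \<in> homogeneous n"
  unfolding homogeneous_def by (rule S.span_base) auto

context
  fixes b :: "'w \<Rightarrow> 'w \<Rightarrow> 'w" and A :: "'w \<Rightarrow> 's \<Rightarrow> 'w" and B :: "'s \<Rightarrow> 's \<Rightarrow> 's"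
  assumes A: "bilinear_map sW sS sW A"
    and A_one: "A u 1 = u" and A_j: "A u (j v) = b u v"
    and B_def: "B \<equiv> conv_ext (\<lambda>u z. j (A u z))"
begin

lemma bilinear_jA: "bilinear_map sW sS sS (\<lambda>u z. j (A u z))"
  using bilinear_mapD[OF A] vs_W vs_S by (auto intro!: bilinear_mapI simp: j_linear)

lemma B_letter: "B (j u) z = j (A u z)"
  by (simp add: B_def conv_ext_j[OF bilinear_jA])

lemma bilinear_B: "bilinear_S sS B"
  unfolding B_def by (rule bilinear_conv_ext[OF bilinear_jA])

lemma B_one_right: "B y 1 = y"
proof (induct y rule: S_induct)
  case one
  show ?case by (simp add: B_def conv_ext_one[OF bilinear_jA] conv_unit_def)
next
  case (letter y u)
  have "B (y * j u) 1 = B (j u) 1 * B y 1"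
    by (simp add: B_def conv_ext_mult_j[OF bilinear_jA] conv_ext_j[OF bilinear_jA] conv_def
        sw_one[OF vs_S bilinear_conv[OF linear_E[OF bilinear_jA] linear_conv_ext[OF bilinear_jA]]])
  then show ?case by (simp add: letter B_letter A_one mult.commute)
qed (simp_all add: bilinear_mapD[OF bilinear_B])

lemma B_one_left: "B 1 z = sS (eps z) 1"
  by (simp add: B_def conv_ext_one[OF bilinear_jA] conv_unit_def)

lemma bilinear_prod:
  assumes "bilinear_S sS C"
  shows "bilinear_S sS (\<lambda>z1 z2. C y z1 * C y' z2)"
  using assms by (intro bilinear_conv) (auto simp: bilinear_map_def)

lemma B_mult: "B (y * y') z = sw sS (\<lambda>z1 z2. B y z1 * B y' z2) z"
  by (simp add: B_def conv_ext_mult[OF bilinear_jA] conv_def)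

text \<open>A generator \<open>v\<close> is primitive, so for it multiplicativity is the Leibniz rule, and a derivation is
  determined by its values on generators.\<close>

lemma derivation_unique:
  assumes C: "bilinear_S sS C" and "\<And>u v. C (j u) (j v) = j (b u v)" and one: "\<And>y. C y 1 = y"
    and "\<And>z. C 1 z = sS (eps z) 1"
    and mult: "\<And>y y' z. C (y * y') z = sw sS (\<lambda>z1 z2. C y z1 * C y' z2) z"
  shows "C (y * y') (j v) = C y (j v) * y' + y * C y' (j v)" and "C y (j v) = B y (j v)"
proof -
  have leibniz: "C (y * y') (j v) = C y (j v) * y' + y * C y' (j v)"
    if C: "bilinear_S sS C" and one: "\<And>y. C y 1 = y"
      and mult: "\<And>y y' z. C (y * y') z = sw sS (\<lambda>z1 z2. C y z1 * C y' z2) z" for C y y'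
    using sw_mult_j[OF vs_S bilinear_prod[OF C, of y y'], of 1 v]
    by (simp add: mult one sw_one[OF vs_S bilinear_shift(1)[OF vs_S bilinear_prod[OF C], simplified]]
        sw_one[OF vs_S bilinear_shift(2)[OF vs_S bilinear_prod[OF C], simplified]])
  show "C (y * y') (j v) = C y (j v) * y' + y * C y' (j v)"
    by (rule leibniz[OF C one mult])
  show "C y (j v) = B y (j v)"
    by (induct y rule: S_induct)
      (simp_all add: assms(2,4) B_one_left B_letter A_j leibniz[OF C one mult]
        leibniz[OF bilinear_B B_one_right B_mult] bilinear_mapD[OF C] bilinear_mapD[OF bilinear_B])
qed

lemma B_prod_homogeneous: "B (prod_list (map j us)) (j v) \<in> homogeneous (length us)"
proof (induct us rule: rev_induct)
  case Nil
  show ?case by (simp add: B_one_left homogeneous_def S.span_zero)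
next
  case (snoc u us)
  have "B (prod_list (map j us) * j u) (j v)
      = B (prod_list (map j us)) (j v) * j u + prod_list (map j us) * j (b u v)"
    by (subst derivation_unique(1)[OF bilinear_B _ B_one_right B_one_left B_mult])
      (simp_all add: B_letter A_j)
  then show ?case
    using homogeneous_mult_j[OF snoc, of u] homogeneous_mult_j[OF homogeneous_prod[OF refl], of us "b u v"]
    by (simp add: homogeneous_def S.span_add)
qed

text \<open>The Leibniz rule fixes \<open>y \<bullet> v\<close> for generators \<open>v\<close> and all \<open>y\<close>; the recursion then
  fixes \<open>u \<bullet> z\<close> by induction on the degree of \<open>z\<close>, and multiplicativity fixes \<open>y \<bullet> z\<close>.  Hence an
  action \<open>A\<close> on \<open>W\<close> that satisfies the recursion is the restriction of the Oudom--Guin extension.\<close>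

theorem oudom_guin_eq:
  assumes A_mult_j: "\<And>u z v. A u (z * j v) = b (A u z) v - A u (B z (j v))"
  shows "oudom_guin sS j sSS tns b = B"
proof -
  have B_recursion: "B (j u) (z * j v) = B (B (j u) z) (j v) - B (j u) (B z (j v))" for u v z
    by (simp add: B_letter A_mult_j j_diff A_j)
  show ?thesis
    unfolding oudom_guin_def
  proof (rule the_equality, safe)
    show "bilinear_map sS sS sS B" by (rule bilinear_B)
    show "B (j u) (j v) = j (b u v)" for u v by (simp add: B_letter A_j)
    show "B y 1 = y" for y by (rule B_one_right)
    show "B 1 z = sS (counit sS j z) 1" for z by (simp add: counit_eq_eps B_one_left)
    show "B (j u) (prod_list (map j us) * j v)
        = B (B (j u) (prod_list (map j us))) (j v) - B (j u) (B (prod_list (map j us)) (j v))" for u us v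
      by (rule B_recursion)
    show "B (y * y') z = sweedler sS j sSS tns (\<lambda>z1 z2. B y z1 * B y' z2) z" for y y' z
      by (simp add: sweedler_eq_sw bilinear_prod[OF bilinear_B] B_mult)
  next
    fix C
    assume C: "bilinear_map sS sS sS C" and b: "\<forall>u v. C (j u) (j v) = j (b u v)"
      and one: "\<forall>y. C y 1 = y" and eps: "\<forall>z. C 1 z = sS (counit sS j z) 1"
      and rec: "\<forall>u us v. C (j u) (prod_list (map j us) * j v)
        = C (C (j u) (prod_list (map j us))) (j v) - C (j u) (C (prod_list (map j us)) (j v))"
      and mult: "\<forall>y y' z. C (y * y') z = sweedler sS j sSS tns (\<lambda>z1 z2. C y z1 * C y' z2) z"
    have mult': "C (y * y') z = sw sS (\<lambda>z1 z2. C y z1 * C y' z2) z" for y y' z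
      using mult by (simp add: sweedler_eq_sw bilinear_prod[OF C])
    have deriv: "C y (j v) = B y (j v)" for y v
      by (rule derivation_unique(2)[OF C]) (use b one eps mult' in \<open>simp_all add: counit_eq_eps\<close>)
    have letter: "C (j u) (prod_list (map j us)) = B (j u) (prod_list (map j us))" for u us
    proof (induct "length us" arbitrary: u us)
      case 0
      then show ?case by (simp add: one B_one_right)
    next
      case (Suc n)
      then obtain us' v where us: "us = us' @ [v]" and n: "length us' = n"
        by (metis length_Suc_conv_rev)
      \<comment> \<open>the product of \<open>us'\<close> acted on by \<open>v\<close> is a combination of other products of the same length\<close>
      have hom: "C (j u) z = B (j u) z" if "z \<in> homogeneous n" for u z
        using that unfolding homogeneous_def
      proof (induct rule: S.span_induct_alt)
        case base
        show ?case using bilinear_map_zero[OF C] bilinear_map_zero[OF bilinear_B] by simp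
      next
        case (step c x y)
        then show ?case
          using Suc(1) by (auto simp: bilinear_mapD[OF C] bilinear_mapD[OF bilinear_B])
      qed
      have "C (j u) (prod_list (map j us))
          = B (B (j u) (prod_list (map j us'))) (j v) - B (j u) (B (prod_list (map j us')) (j v))"
        using rec hom[OF homogeneous_prod[OF n]] hom[OF B_prod_homogeneous[of us' v, unfolded n]]
        by (simp add: us deriv)
      then show ?case by (simp add: us B_recursion)
    qed
    have letter': "C (j u) z = B (j u) z" for u z
    proof (induct z rule: mono_induct)
      case (mono M)
      obtain us where "mset us = M" using ex_mset by blast
      then have "mono M = prod_list (map j us)" by (auto simp flip: prod_mset_prod_list)
      then show ?case by (simp only: letter)
    qed (simp_all add: bilinear_mapD[OF C] bilinear_mapD[OF bilinear_B])
    have "C y z = B y z" for y z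
    proof (induct y arbitrary: z rule: S_induct)
      case one
      show ?case by (simp add: eps counit_eq_eps B_one_left)
    qed (simp_all add: mult' B_mult letter' bilinear_mapD[OF C] bilinear_mapD[OF bilinear_B])
    then show "C = B" by blast
  qed
qed

end

end

section \<open>The action of the symmetric algebra on words\<close>

locale word_oudom_guin =
  word_prelie sV sT \<iota> f + symmetric_coalg sT sS j sSS tns
  for sV :: "'k::field \<Rightarrow> 'v::ab_group_add \<Rightarrow> 'v"
    and sT :: "'k \<Rightarrow> 't::ring_1 \<Rightarrow> 't" and \<iota> and f
    and sS :: "'k \<Rightarrow> 's::comm_ring_1 \<Rightarrow> 's" and j
    and sSS :: "'k \<Rightarrow> 'ss::ring_1 \<Rightarrow> 'ss" and tns
begin

text \<open>For \<open>z = w\<^sub>1 \<times> \<dots> \<times> w\<^sub>k\<close> this is \<open>f\<^sup>k(x)\<close> followed by the shuffle of \<open>t, w\<^sub>1, \<dots>, w\<^sub>k\<close>, the shape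
  of the summands of \<open>xw \<bullet> z\<close>.\<close>

definition letter_shuffle :: "'v \<Rightarrow> 't \<Rightarrow> 's \<Rightarrow> 't" where
  "letter_shuffle x t = lift_S sT (\<lambda>M. \<iota> ((f ^^ size M) x) * fold_mset (\<lambda>a s. sh s a) t M)"

lemma
  shows letter_shuffle_linear_right: "letter_shuffle x t (y + z) = letter_shuffle x t y + letter_shuffle x t z"
      "letter_shuffle x t (sS c z) = sT c (letter_shuffle x t z)"
    and letter_shuffle_one: "letter_shuffle x t 1 = \<iota> x * t"
    and letter_shuffle_mult_j: "letter_shuffle x t (z * j a) = letter_shuffle (f x) (sh t a) z"
proof -
  let ?P = "\<lambda>a s. sh s a"
  interpret comp_fun_commute ?P
    by unfold_locales (simp add: fun_eq_iff sh_right_commute)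
  have "sym_multilinear sT (\<lambda>M. \<iota> ((f ^^ size M) x) * fold_mset ?P t M)" for x t
    by (rule sym_multilinearI; unfold fold_mset_add_mset size_add_mset)
      (simp_all add: sh_linear distrib_left scale_mult)
  note L = lift_S_simps[OF vs_T this]
  show lin: "letter_shuffle x t (y + z) = letter_shuffle x t y + letter_shuffle x t z"
      "letter_shuffle x t (sS c z) = sT c (letter_shuffle x t z)" for x t y z c
    by (simp_all add: letter_shuffle_def L)
  show "letter_shuffle x t 1 = \<iota> x * t" using L(3)[of x t "{#}"] by (simp add: letter_shuffle_def)
  show "letter_shuffle x t (z * j a) = letter_shuffle (f x) (sh t a) z"
  proof (induct z rule: mono_induct)
    case (mono M)
    have "mono M * j a = mono (add_mset a M)" by (simp add: mult.commute)
    then have "letter_shuffle x t (mono M * j a) = \<iota> ((f ^^ Suc (size M)) x) * fold_mset ?P t (add_mset a M)"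
      by (simp only: letter_shuffle_def L size_add_mset)
    also have "\<dots> = \<iota> ((f ^^ size M) (f x)) * fold_mset ?P (sh t a) M"
      unfolding fold_mset_add_mset fold_mset_fun_left_comm by (simp add: funpow_swap1)
    also have "\<dots> = letter_shuffle (f x) (sh t a) (mono M)"
      by (simp only: letter_shuffle_def L)
    finally show ?case .
  qed (simp_all add: lin distrib_right S_scale_mult)
qed

lemma letter_shuffle_linear_mid: "letter_shuffle x (t + t') z = letter_shuffle x t z + letter_shuffle x t' z"
    "letter_shuffle x (sT c t) z = sT c (letter_shuffle x t z)"
  and letter_shuffle_linear_left: "letter_shuffle (x + y) t z = letter_shuffle x t z + letter_shuffle y t z"
    "letter_shuffle (sV c x) t z = sT c (letter_shuffle x t z)"
proof -
  show "letter_shuffle x (t + t') z = letter_shuffle x t z + letter_shuffle x t' z"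
    by (induct z arbitrary: x t t' rule: S_induct)
      (simp_all add: letter_shuffle_one letter_shuffle_mult_j letter_shuffle_linear_right sh_linear
        distrib_left T.scale_right_distrib)
  show "letter_shuffle x (sT c t) z = sT c (letter_shuffle x t z)"
    by (induct z arbitrary: x t rule: S_induct)
      (simp_all add: letter_shuffle_one letter_shuffle_mult_j letter_shuffle_linear_right sh_linear
        scale_mult T.scale_right_distrib mult.commute)
  show "letter_shuffle (x + y) t z = letter_shuffle x t z + letter_shuffle y t z"
    by (induct z arbitrary: x y t rule: S_induct)
      (simp_all add: letter_shuffle_one letter_shuffle_mult_j letter_shuffle_linear_right f_linear
        iota_add distrib_right T.scale_right_distrib)
  show "letter_shuffle (sV c x) t z = sT c (letter_shuffle x t z)"
    by (induct z arbitrary: x t rule: S_induct)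
      (simp_all add: letter_shuffle_one letter_shuffle_mult_j letter_shuffle_linear_right f_linear
        iota_scale scale_mult T.scale_right_distrib mult.commute)
qed

lemmas letter_shuffle_linear = letter_shuffle_linear_left letter_shuffle_linear_mid letter_shuffle_linear_right

lemma linear_letter_shuffle: "Vector_Spaces.linear sS sT (letter_shuffle x t)"
  using vs_S vs_T by (simp add: Vector_Spaces.linear_iff letter_shuffle_linear)

lemma bilinear_letter_shuffle:
  assumes "Vector_Spaces.linear sS sT F"
  shows "bilinear_S sT (\<lambda>z1 z2. letter_shuffle x (F z1) z2)"
  using vs_S vs_T by (auto intro!: bilinear_mapI simp: letter_shuffle_linear linearD[OF assms])

text \<open>The formula for \<open>xw \<bullet> z\<close> is taken as the definition of the action: the sum over subsets is the
  Sweedler sum of \<open>f\<^sup>d(x) ((w \<bullet> z\<^sup>(\<^sup>1\<^sup>)) \<squnion> z\<^sup>(\<^sup>2\<^sup>))\<close>, where \<open>d\<close> is the degree of \<open>z\<^sup>(\<^sup>2\<^sup>)\<close>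
  and \<open>\<squnion>\<close> stands for the shuffle with every factor of \<open>z\<^sup>(\<^sup>2\<^sup>)\<close>.\<close>

primrec word_act :: "'v list \<Rightarrow> 's \<Rightarrow> 't" where
  "word_act [] z = sT (eps z) 1"
| "word_act (x # xs) z = sw sT (\<lambda>z1 z2. letter_shuffle x (word_act xs z1) z2) z"

lemma linear_word_act: "Vector_Spaces.linear sS sT (word_act xs)"
proof (induct xs)
  case Nil
  show ?case
    using vs_S vs_T by (simp add: Vector_Spaces.linear_iff eps_linear T.scale_left_distrib)
next
  case (Cons x xs)
  show ?case
    using vs_S vs_T by (simp add: Vector_Spaces.linear_iff sw_linear[OF vs_T bilinear_letter_shuffle[OF Cons]])
qed

lemma multilinear_word_act: "multilinear sT (\<lambda>xs. word_act xs z)"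
proof (rule multilinearI)
  note b = bilinear_letter_shuffle[OF linear_word_act]
  show "word_act (u @ (x + y) # v) z = word_act (u @ x # v) z + word_act (u @ y # v) z" for u x y v
    by (induct u arbitrary: z) (simp_all add: letter_shuffle_linear sw_add[OF vs_T b b])
  show "word_act (u @ sV c x # v) z = sT c (word_act (u @ x # v) z)" for u c x v
    by (induct u arbitrary: z) (simp_all add: letter_shuffle_linear sw_scale[OF vs_T b])
qed

definition act :: "'t \<Rightarrow> 's \<Rightarrow> 't" where
  "act w z = lift_T sT (\<lambda>xs. word_act xs z) w"

lemma act_linear_left: "act (a + b) z = act a z + act b z" "act (sT c a) z = sT c (act a z)"
  and act_word: "act (word xs) z = word_act xs z"
  by (simp_all add: act_def lift_T_simps[OF vs_T multilinear_word_act])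

lemma act_linear_right: "act w (y + z) = act w y + act w z" "act w (sS c z) = sT c (act w z)"
proof -
  show "act w (y + z) = act w y + act w z"
    by (induct w rule: word_induct)
      (simp_all add: act_linear_left act_word linearD[OF linear_word_act] T.scale_right_distrib)
  show "act w (sS c z) = sT c (act w z)"
    by (induct w rule: word_induct)
      (simp_all add: act_linear_left act_word linearD[OF linear_word_act] T.scale_right_distrib mult.commute)
qed

lemmas act_linear = act_linear_left act_linear_right

lemma bilinear_act: "bilinear_map sT sS sT act"
  using vs_S vs_T by (auto intro!: bilinear_mapI simp: act_linear)

lemma linear_act: "Vector_Spaces.linear sS sT (act w)"
  using bilinear_act by (auto simp: bilinear_map_def)

lemma act_empty: "act 1 z = sT (eps z) 1"
  using act_word[of "[]"] by simp

lemma act_letter: "act (\<iota> x * w) z = sw sT (\<lambda>z1 z2. letter_shuffle x (act w z1) z2) z"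
proof (induct w rule: word_induct)
  case (word xs)
  show ?case using act_word[of "x # xs"] by (simp add: act_word)
next
  case (add a b)
  then show ?case
    by (simp add: distrib_left act_linear letter_shuffle_linear
        sw_add[OF vs_T bilinear_letter_shuffle[OF linear_act] bilinear_letter_shuffle[OF linear_act]])
next
  case (scale c a)
  then show ?case
    by (simp add: scale_mult act_linear letter_shuffle_linear sw_scale[OF vs_T bilinear_letter_shuffle[OF linear_act]])
qed

lemma sw_letter_shuffle_mult_j:
  "sw sT (\<lambda>z1 z2. letter_shuffle x (act w z1) z2) (z * j v)
    = sw sT (\<lambda>z1 z2. letter_shuffle x (act w (z1 * j v)) z2) z
      + sw sT (\<lambda>z1 z2. letter_shuffle (f x) (sh (act w z1) v) z2) z"
  by (simp add: sw_mult_j[OF vs_T bilinear_letter_shuffle[OF linear_act]] letter_shuffle_mult_j)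

lemma act_unit: "act w 1 = w"
  by (induct w rule: T_induct)
    (simp_all add: act_empty act_letter act_linear sw_one[OF vs_T bilinear_letter_shuffle[OF linear_act]] letter_shuffle_one)

lemma act_j: "act w (j v) = pl w v"
proof (induct w rule: T_induct)
  case (letter x w)
  have s: "Vector_Spaces.linear sS sT (\<lambda>z. act w (z * j v))" "Vector_Spaces.linear sS sT (\<lambda>z. sh (act w z) v)"
    using vs_S vs_T by (simp_all add: Vector_Spaces.linear_iff distrib_right S_scale_mult act_linear sh_linear)
  show ?case
    using sw_letter_shuffle_mult_j[of x w 1 v]
    by (simp add: act_letter sw_one[OF vs_T bilinear_letter_shuffle[OF s(1)]] sw_one[OF vs_T bilinear_letter_shuffle[OF s(2)]]
        letter_shuffle_one act_unit letter pl_letter)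
qed (simp_all add: act_empty act_linear pl_linear)

definition og :: "'s \<Rightarrow> 's \<Rightarrow> 's" where
  "og = conv_ext (\<lambda>w z. j (act w z))"

lemmas bilinear_og = bilinear_B[OF bilinear_act act_unit act_j og_def[THEN eq_reflection]]
  and og_letter = B_letter[OF bilinear_act act_unit act_j og_def[THEN eq_reflection]]
  and og_one_left = B_one_left[OF bilinear_act act_unit act_j og_def[THEN eq_reflection]]
  and og_one_right = B_one_right[OF bilinear_act act_unit act_j og_def[THEN eq_reflection]]
  and og_mult = B_mult[OF bilinear_act act_unit act_j og_def[THEN eq_reflection]]

lemmas og_linear = bilinear_mapD[OF bilinear_og]

lemma og_leibniz: "og (z * j a) (j v) = og z (j v) * j a + z * j (pl a v)"
  by (subst derivation_unique(1)[OF bilinear_act act_unit act_j og_def[THEN eq_reflection] bilinear_og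
        _ og_one_right og_one_left og_mult])
    (simp_all add: og_letter act_j)

lemma og_one_j: "og 1 (j v) = 0"
  by (simp add: og_one_left)

lemma eps_zero: "eps 0 = 0"
  using eps_linear(2)[of 0 0] by simp

lemma eps_og_j: "eps (og z (j v)) = 0"
  by (induct z rule: S_induct)
    (simp_all add: og_one_j og_linear og_leibniz eps_linear eps_zero)

lemma linear_sw:
  assumes "vector_space sX" "bilinear_S sX h"
  shows "Vector_Spaces.linear sS sX (sw sX h)"
  using vs_S assms by (simp add: Vector_Spaces.linear_iff sw_linear)

text \<open>The derivation \<open>D = (_ \<bullet> v)\<close> maps generators to generators, so it is also a coderivation:
  \<open>\<Delta> D = (D \<otimes> id + id \<otimes> D) \<Delta>\<close>.\<close>

lemma sw_og_j:
  assumes X: "vector_space sX" and "bilinear_S sX h"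
  shows "sw sX h (og z (j v)) = sw sX (\<lambda>a b. h (og a (j v)) b + h a (og b (j v))) z"
  using assms(2)
proof (induct z arbitrary: h rule: S_induct)
  interpret X: vector_space sX by fact
  have bil: "bilinear_S sX (\<lambda>a b. h (og a (j v)) b + h a (og b (j v)))" if "bilinear_S sX h" for h
    using vs_S X
    by (auto intro!: bilinear_mapI simp: og_linear bilinear_mapD[OF that] add_ac X.scale_right_distrib)
  {
    case one
    then show ?case
      using bilinear_map_zero[OF one] by (simp add: og_one_j sw_one[OF X bil] linear_0[OF linear_sw[OF X one]])
  next
    case (letter z a)
    note h = letter(2)
    note sh1 = bilinear_shift(1)[OF X h] and sh2 = bilinear_shift(2)[OF X h]
    have "sw sX h (og (z * j a) (j v)) =
        sw sX (\<lambda>p q. h (og p (j v) * j a) q + h (p * j a) (og q (j v))) z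
        + sw sX (\<lambda>p q. h (og p (j v)) (q * j a) + h p (og q (j v) * j a)) z
        + (sw sX (\<lambda>p q. h (p * j (pl a v)) q) z + sw sX (\<lambda>p q. h p (q * j (pl a v))) z)"
      by (simp add: og_leibniz sw_linear[OF X h] sw_mult_j[OF X h] letter(1)[OF sh1] letter(1)[OF sh2])
    also have "\<dots> = sw sX (\<lambda>p q. h (og (p * j a) (j v)) q + h (p * j a) (og q (j v))) z
        + sw sX (\<lambda>p q. h (og p (j v)) (q * j a) + h p (og (q * j a) (j v))) z"
    proof -
      note b = bilinear_shift(1)[OF X h, of "j (pl a v)"] bilinear_shift(2)[OF X h, of "j (pl a v)"]
      have "(\<lambda>p q. h (og (p * j a) (j v)) q + h (p * j a) (og q (j v)))
          = (\<lambda>p q. (h (og p (j v) * j a) q + h (p * j a) (og q (j v))) + h (p * j (pl a v)) q)"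
        "(\<lambda>p q. h (og p (j v)) (q * j a) + h p (og (q * j a) (j v)))
          = (\<lambda>p q. (h (og p (j v)) (q * j a) + h p (og q (j v) * j a)) + h p (q * j (pl a v)))"
        by (simp_all add: og_leibniz bilinear_mapD[OF h] add_ac)
      then show ?thesis
        by (simp only: sw_add[OF X bil[OF sh1] b(1)] sw_add[OF X bil[OF sh2] b(2)]) (simp add: add_ac)
    qed
    also have "\<dots> = sw sX (\<lambda>p q. h (og p (j v)) q + h p (og q (j v))) (z * j a)"
      by (simp add: sw_mult_j[OF X bil[OF h]])
    finally show ?case .
  next
    case (add y z)
    then show ?case by (simp add: og_linear sw_linear[OF X bil] sw_linear[OF X])
  next
    case (scale c z)
    then show ?case by (simp add: og_linear sw_linear[OF X bil] sw_linear[OF X])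
  }
qed

text \<open>Right multiplication by \<open>v\<close> hits the leading letter, the word \<open>t\<close>, or one of the factors of \<open>z\<close>.\<close>

lemma letter_shuffle_pl:
  "pl (letter_shuffle x t z) v
    = letter_shuffle x (pl t v) z + letter_shuffle x t (og z (j v)) + letter_shuffle (f x) (sh t v) z"
proof (induct z arbitrary: x t rule: S_induct)
  case one
  show ?case by (simp add: letter_shuffle_one pl_letter og_one_j linear_0[OF linear_letter_shuffle])
next
  case (letter z a)
  show ?case
    by (simp add: letter_shuffle_mult_j og_leibniz letter_shuffle_linear letter pl_sh sh_right_commute[of t a v])
next
  case (add y z)
  then show ?case by (simp add: letter_shuffle_linear pl_linear og_linear)
next
  case (scale c z)
  then show ?case by (simp add: letter_shuffle_linear pl_linear og_linear T.scale_right_distrib)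
qed

text \<open>The Oudom--Guin recursion holds for the action, by induction on the word.  In
  \<open>xw \<bullet> (z \<times> v)\<close> the factor \<open>v\<close> goes either to \<open>w\<close> or into the outer shuffle.  In
  \<open>(xw \<bullet> z) \<bullet> v\<close> the word \<open>v\<close> hits the leading letter, which gives the second contribution, or
  \<open>w \<bullet> z\<^sup>(\<^sup>1\<^sup>)\<close>, or a factor of \<open>z\<^sup>(\<^sup>2\<^sup>)\<close>.  The last two, minus \<open>xw \<bullet> (z \<bullet> v)\<close> expanded by the
  coderivation property, leave the first contribution by the induction hypothesis.\<close>

lemma act_mult_j: "act w (z * j v) = pl (act w z) v - act w (og z (j v))"
proof (induct w arbitrary: z rule: T_induct)
  case one
  show ?case by (simp add: act_empty eps_og_j pl_linear)
next
  case (letter x w)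
  have pl: "Vector_Spaces.linear sT sT (\<lambda>t. pl t v)"
    using bilinear_pl by (auto simp: bilinear_map_def)
  have s: "Vector_Spaces.linear sS sT (\<lambda>z. pl (act w z) v)" "Vector_Spaces.linear sS sT (\<lambda>z. act w (z * j v))"
     "Vector_Spaces.linear sS sT (\<lambda>z. sh (act w z) v)" "Vector_Spaces.linear sS sT (\<lambda>z. act w (og z (j v)))"
    using vs_S vs_T
    by (simp_all add: Vector_Spaces.linear_iff distrib_right S_scale_mult act_linear sh_linear pl_linear og_linear)
  let ?h = "\<lambda>z1 z2. letter_shuffle x (act w z1) z2"
  let ?sw = "\<lambda>h. sw sT h z"
  note h = bilinear_letter_shuffle[OF linear_act]
  have h': "bilinear_S sT (\<lambda>z1 z2. ?h (og z1 (j v)) z2 + ?h z1 (og z2 (j v)))"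
    using vs_S vs_T
    by (auto intro!: bilinear_mapI simp: act_linear letter_shuffle_linear og_linear add_ac T.scale_right_distrib)
  have h'': "bilinear_S sT (\<lambda>z1 z2. letter_shuffle x (act w (z1 * j v)) z2 + (?h (og z1 (j v)) z2 + ?h z1 (og z2 (j v))))"
    using vs_S vs_T
    by (auto intro!: bilinear_mapI simp: act_linear letter_shuffle_linear og_linear add_ac T.scale_right_distrib
        distrib_right S_scale_mult)
  have e: "pl (act w y) v = act w (y * j v) + act w (og y (j v))" for y
    using letter[of y] by simp
  have "pl (act (\<iota> x * w) z) v = ?sw (\<lambda>z1 z2. pl (?h z1 z2) v)"
    by (simp add: act_letter sw_image[OF vs_T h pl])
  also have "\<dots> = ?sw (\<lambda>z1 z2. letter_shuffle x (act w (z1 * j v)) z2 + (?h (og z1 (j v)) z2 + ?h z1 (og z2 (j v)))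
      + letter_shuffle (f x) (sh (act w z1) v) z2)"
    by (simp add: letter_shuffle_pl e letter_shuffle_linear add_ac)
  also have "\<dots> = ?sw (\<lambda>z1 z2. letter_shuffle x (act w (z1 * j v)) z2)
      + ?sw (\<lambda>z1 z2. ?h (og z1 (j v)) z2 + ?h z1 (og z2 (j v)))
      + ?sw (\<lambda>z1 z2. letter_shuffle (f x) (sh (act w z1) v) z2)"
    by (simp only: sw_add[OF vs_T h'' bilinear_letter_shuffle[OF s(3)]] sw_add[OF vs_T bilinear_letter_shuffle[OF s(2)] h'])
  also have "?sw (\<lambda>z1 z2. ?h (og z1 (j v)) z2 + ?h z1 (og z2 (j v))) = act (\<iota> x * w) (og z (j v))"
    by (simp add: act_letter sw_og_j[OF vs_T h])
  finally show ?case
    by (simp add: act_letter[of x w "z * j v"] sw_letter_shuffle_mult_j)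
next
  case (add a b)
  then show ?case by (simp add: act_linear pl_linear)
next
  case (scale c a)
  then show ?case by (simp add: act_linear pl_linear T.scale_right_diff_distrib)
qed

theorem oudom_guin_eq_og: "oudom_guin sS j sSS tns (prelie sT \<iota> f) = og"
  unfolding prelie_eq_pl
  by (rule oudom_guin_eq[OF bilinear_act act_unit act_j og_def[THEN eq_reflection] act_mult_j])

section \<open>The four formulas\<close>

lemma letter_shuffle_prod_list:
  "letter_shuffle x t (prod_list (map j us)) = \<iota> ((f ^^ length us) x) * sh t (foldr sh us 1)"
proof (induct us arbitrary: x t)
  case Nil
  show ?case by (simp add: letter_shuffle_one)
next
  case (Cons u us)
  show ?case
    using Cons[of "f x" "sh t u"] by (simp add: mult.commute[of "j u"] letter_shuffle_mult_j funpow_swap1 sh_assoc)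
qed

lemma letter_shuffle_prod:
  assumes "finite I"
  shows "letter_shuffle x t (\<Prod>i\<in>I. j (ws i)) = \<iota> ((f ^^ card I) x) * sh t (shuffle_set sT \<iota> ws I)"
proof -
  let ?us = "map ws (sorted_list_of_set I)"
  have "(\<Prod>i\<in>I. j (ws i)) = prod_list (map j ?us)"
    using prod.distinct_set_conv_list[of "sorted_list_of_set I" "\<lambda>i. j (ws i)"] assms
    by (simp add: comp_def)
  then show ?thesis
    using letter_shuffle_prod_list[of x t ?us] by (simp add: shuffle_set_def shuffle_eq_sh)
qed

lemma act_letter_prod:
  assumes "finite K"
  shows "act (\<iota> x * w) (\<Prod>i\<in>K. j (ws i)) = (\<Sum>I\<in>Pow K. \<iota> ((f ^^ card (K - I)) x)
      * sh (act w (\<Prod>i\<in>I. j (ws i))) (shuffle_set sT \<iota> ws (K - I)))"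
  using assms by (simp add: act_letter sw_prod[OF vs_T _ bilinear_letter_shuffle[OF linear_act]] letter_shuffle_prod)

lemma eps_prod:
  assumes "finite K" "K \<noteq> {}"
  shows "eps (\<Prod>i\<in>K. j (ws i)) = 0"
  using assms by (induct K rule: finite_ne_induct) (simp_all add: eps_mult)

lemma oudom_guin_elem_eq_act: "oudom_guin_elem sS j sSS tns (prelie sT \<iota> f) w z = act w z"
  unfolding oudom_guin_elem_def oudom_guin_eq_og og_letter
  using inj_j by (auto simp: inj_eq)

lemma bilinear_star: "bilinear_S sS (\<lambda>z1 z2. og y z1 * z2)"
  using vs_S by (auto intro!: bilinear_mapI simp: og_linear algebra_simps S_scale_mult)

lemma star_eq: "star sS j sSS tns (prelie sT \<iota> f) y z = sw sS (\<lambda>z1 z2. og y z1 * z2) z"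
  by (simp add: star_def oudom_guin_eq_og sweedler_eq_sw bilinear_star)

lemma star_empty: "star sS j sSS tns (prelie sT \<iota> f) (j 1) z = j 1 * z"
proof -
  have "Vector_Spaces.linear sS sS ((*) (j 1))"
    using vs_S by (simp add: Vector_Spaces.linear_iff distrib_left S_scale_mult)
  from sw_counit[OF vs_S this, of z] show ?thesis
    by (simp add: star_eq og_letter act_empty j_linear S_scale_mult)
qed

text \<open>The coproduct in \<open>\<star>\<close> splits off \<open>L\<close>, and the action then splits the complement into \<open>I\<close> and
  \<open>J\<close>.\<close>

lemma star_letter_prod:
  assumes "finite K"
  shows "star sS j sSS tns (prelie sT \<iota> f) (j (\<iota> x * w)) (\<Prod>i\<in>K. j (ws i))
    = (\<Sum>(I, J, L)\<in>{(I, J, L). I \<union> J \<union> L = K \<and> I \<inter> J = {} \<and> I \<inter> L = {} \<and> J \<inter> L = {}}.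
        j (\<iota> ((f ^^ card J) x) * sh (act w (\<Prod>i\<in>I. j (ws i))) (shuffle_set sT \<iota> ws J))
          * (\<Prod>i\<in>L. j (ws i)))"
proof -
  let ?W = "\<lambda>I. \<Prod>i\<in>I. j (ws i)"
  let ?t = "\<lambda>I J. j (\<iota> ((f ^^ card J) x) * sh (act w (?W I)) (shuffle_set sT \<iota> ws J))"
  have "star sS j sSS tns (prelie sT \<iota> f) (j (\<iota> x * w)) (?W K)
      = (\<Sum>P\<in>Pow K. j (act (\<iota> x * w) (?W P)) * ?W (K - P))"
    by (simp only: star_eq sw_prod[OF vs_S assms bilinear_star]) (simp only: og_letter)
  also have "\<dots> = (\<Sum>P\<in>Pow K. \<Sum>I\<in>Pow P. ?t I (P - I) * ?W (K - P))"
    using assms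
    by (intro sum.cong) (auto simp: act_letter_prod finite_subset j_sum sum_distrib_right)
  also have "\<dots> = (\<Sum>(P, I)\<in>(SIGMA P:Pow K. Pow P). ?t I (P - I) * ?W (K - P))"
    using assms by (intro sum.Sigma) (auto simp: finite_subset)
  also have "\<dots> = (\<Sum>(I, J, L)\<in>{(I, J, L). I \<union> J \<union> L = K \<and> I \<inter> J = {} \<and> I \<inter> L = {} \<and> J \<inter> L = {}}.
      ?t I J * ?W L)"
    by (rule sum.reindex_bij_witness[where i = "\<lambda>(I, J, L). (I \<union> J, I)"
          and j = "\<lambda>(P, I). (I, P - I, K - P)"]) (auto intro!: arg_cong2[where f = "\<lambda>A B. ?t _ A * ?W B"])
  finally show ?thesis .
qed

end

theorem theorem12:
  fixes sV :: "'k::field_char_0 \<Rightarrow> 'v::ab_group_add \<Rightarrow> 'v"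
    and sT :: "'k \<Rightarrow> 't::ring_1 \<Rightarrow> 't" and \<iota> :: "'v \<Rightarrow> 't"
    and sS :: "'k \<Rightarrow> 's::comm_ring_1 \<Rightarrow> 's" and j :: "'t \<Rightarrow> 's"
    and sSS :: "'k \<Rightarrow> 'ss::ring_1 \<Rightarrow> 'ss" and tns :: "'s \<Rightarrow> 's \<Rightarrow> 'ss"
    and f :: "'v \<Rightarrow> 'v" and k :: nat and ws :: "nat \<Rightarrow> 't" and x :: 'v and w :: 't
  assumes "vector_space sV"
    and "tensor_algebra sV sT \<iota>"
    and "symmetric_algebra sT sS j"
    and "tensor_square sS sSS tns"
    and "Vector_Spaces.linear sV sV f"
  shows
    "let sh = shuffle sT \<iota>;
         bu = oudom_guin sS j sSS tns (prelie sT \<iota> f);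
         buT = oudom_guin_elem sS j sSS tns (prelie sT \<iota> f);
         st = star sS j sSS tns (prelie sT \<iota> f);
         W = (\<lambda>I. \<Prod>i\<in>I. j (ws i));
         Wsh = shuffle_set sT \<iota> ws
     in
       (k \<ge> 1 \<longrightarrow> bu (j 1) (W {1..k}) = 0) \<and>
       bu (j (\<iota> x * w)) (W {1..k})
         = j (\<Sum>I\<in>Pow {1..k}.
               \<iota> ((f ^^ (k - card I)) x) * sh (buT w (W I)) (Wsh ({1..k} - I))) \<and>
       st (j 1) (W {1..k}) = j 1 * W {1..k} \<and>
       st (j (\<iota> x * w)) (W {1..k})
         = (\<Sum>(I, J, K)\<in>{(I, J, K). I \<union> J \<union> K = {1..k} \<and>
                 I \<inter> J = {} \<and> I \<inter> K = {} \<and> J \<inter> K = {}}.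
             j (\<iota> ((f ^^ card J) x) * sh (buT w (W I)) (Wsh J)) * W K)"
proof -
  interpret word_oudom_guin sV sT \<iota> f sS j sSS tns
    using assms
    by (simp add: word_oudom_guin_def word_prelie_def word_prelie_axioms_def tensor_alg_def
        symmetric_coalg_def symmetric_coalg_axioms_def symmetric_alg_def)
  let ?W = "\<lambda>I. \<Prod>i\<in>I. j (ws i)"
  have 1: "og (j 1) (?W {1..k}) = 0" if "k \<ge> 1"
    using that by (simp add: og_letter act_empty eps_prod j_0)
  have 2: "og (j (\<iota> x * w)) (?W {1..k})
      = j (\<Sum>I\<in>Pow {1..k}. \<iota> ((f ^^ (k - card I)) x) * sh (act w (?W I)) (shuffle_set sT \<iota> ws ({1..k} - I)))"
  proof -
    have "card ({1..k} - I) = k - card I" if "I \<in> Pow {1..k}" for I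
      using that by (simp add: card_Diff_subset finite_subset)
    then show ?thesis
      unfolding og_letter act_letter_prod[OF finite_atLeastAtMost]
      by (intro arg_cong[where f = j] sum.cong) simp_all
  qed
  show ?thesis
    unfolding Let_def oudom_guin_eq_og oudom_guin_elem_eq_act shuffle_eq_sh
    using 1 2 star_empty star_letter_prod[of "{1..k}" x w ws] by simp
qed

end
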